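(* A finitely cocomplete homological category $\mathbb C$ is semi-abelian (i.e. Barr exact) if and only if the following condition holds: (P) A subobject $X$ of an object $A$ of $\mathbb C$ is proper in $A$ if and only if it is stable under the conjugation action of $A$, i.e. if and only if $[X,A]\subset X$.
   Context: Homological means pointed, finitely complete, regular and protomodular. A subobject is proper if it is the kernel of some map. For objects $X,Y$, $(X|Y)$ is the kernel of the canonical map $X+Y\to X\times Y$, with inclusion $\iota:(X|Y)\to X+Y$; for $f:X\to X'$, $g:Y\to Y'$, $(f|g):(X|Y)\to(X'|Y')$ is the map with $\iota(f|g)=(f+g)\iota$. For an object $A$, $c_2^A=\nabla_A\,\iota_{A,A}:(A|A)\to A$, with $\nabla_A=\langle1,1\rangle:A+A\to A$; this is the conjugation action of $A$ on itself. For subobjects $x:X\to A$, $y:Y\to A$, the commutator $[X,Y]$ is the subobject of $A$ given by the image of $c_2^A(x|y):(X|Y)\to A$. A subobject $x:X\to A$ is stable under the conjugation action of $A$ if $c_2^A(x|1_A):(X|A)\to A$ factors through $x$. *)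

theory Defs
  imports Main
begin

section \<open>Categories\<close>

text \<open>Composition is written in applicative order; it is meaningful only on composable arrows,
  and equations between arrows are only ever stated for arrows of the category.\<close>

record ('o, 'm) cat =
  Obj :: "'o set"
  Arr :: "'m set"
  Dom :: "'m \<Rightarrow> 'o"
  Cod :: "'m \<Rightarrow> 'o"
  Ident :: "'o \<Rightarrow> 'm"
  Comp :: "'m \<Rightarrow> 'm \<Rightarrow> 'm"  (infixr "\<cdot>\<index>" 70)

definition hom :: "('o, 'm) cat \<Rightarrow> 'o \<Rightarrow> 'o \<Rightarrow> 'm set" where
  "hom C a b = {f \<in> Arr C. Dom C f = a \<and> Cod C f = b}"

locale category =
  fixes C :: "('o, 'm) cat" (structure)
  assumes Dom_in_Obj: "f \<in> Arr C \<Longrightarrow> Dom C f \<in> Obj C"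
    and Cod_in_Obj: "f \<in> Arr C \<Longrightarrow> Cod C f \<in> Obj C"
    and Ident_in_hom: "a \<in> Obj C \<Longrightarrow> Ident C a \<in> hom C a a"
    and Comp_in_hom: "f \<in> hom C a b \<Longrightarrow> g \<in> hom C b c \<Longrightarrow> g \<cdot> f \<in> hom C a c"
    and Comp_assoc:
      "f \<in> hom C a b \<Longrightarrow> g \<in> hom C b c \<Longrightarrow> h \<in> hom C c d \<Longrightarrow> (h \<cdot> g) \<cdot> f = h \<cdot> (g \<cdot> f)"
    and Comp_Ident_right: "f \<in> hom C a b \<Longrightarrow> f \<cdot> Ident C a = f"
    and Comp_Ident_left: "f \<in> hom C a b \<Longrightarrow> Ident C b \<cdot> f = f"

definition monic :: "('o, 'm) cat \<Rightarrow> 'm \<Rightarrow> bool" where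
  "monic C m \<longleftrightarrow> m \<in> Arr C \<and>
     (\<forall>t. \<forall>g \<in> hom C t (Dom C m). \<forall>h \<in> hom C t (Dom C m).
        m \<cdot>\<^bsub>C\<^esub> g = m \<cdot>\<^bsub>C\<^esub> h \<longrightarrow> g = h)"

definition iso :: "('o, 'm) cat \<Rightarrow> 'm \<Rightarrow> bool" where
  "iso C f \<longleftrightarrow> f \<in> Arr C \<and>
     (\<exists>g \<in> hom C (Cod C f) (Dom C f).
        g \<cdot>\<^bsub>C\<^esub> f = Ident C (Dom C f) \<and> f \<cdot>\<^bsub>C\<^esub> g = Ident C (Cod C f))"

definition is_functor ::
  "('i, 'u) cat \<Rightarrow> ('o, 'm) cat \<Rightarrow> ('i \<Rightarrow> 'o) \<Rightarrow> ('u \<Rightarrow> 'm) \<Rightarrow> bool" where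
  "is_functor J C Fo Fa \<longleftrightarrow>
     (\<forall>i \<in> Obj J. Fo i \<in> Obj C \<and> Fa (Ident J i) = Ident C (Fo i)) \<and>
     (\<forall>u \<in> Arr J. Fa u \<in> hom C (Fo (Dom J u)) (Fo (Cod J u))) \<and>
     (\<forall>u \<in> Arr J. \<forall>v \<in> Arr J. Cod J u = Dom J v \<longrightarrow>
        Fa (v \<cdot>\<^bsub>J\<^esub> u) = Fa v \<cdot>\<^bsub>C\<^esub> Fa u)"


section \<open>Limits and colimits\<close>

definition is_cone ::
  "('i, 'u) cat \<Rightarrow> ('o, 'm) cat \<Rightarrow> ('i \<Rightarrow> 'o) \<Rightarrow> ('u \<Rightarrow> 'm) \<Rightarrow> 'o \<Rightarrow> ('i \<Rightarrow> 'm) \<Rightarrow> bool" where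
  "is_cone J C Fo Fa L p \<longleftrightarrow> L \<in> Obj C \<and>
     (\<forall>i \<in> Obj J. p i \<in> hom C L (Fo i)) \<and>
     (\<forall>u \<in> Arr J. Fa u \<cdot>\<^bsub>C\<^esub> p (Dom J u) = p (Cod J u))"

definition is_limit ::
  "('i, 'u) cat \<Rightarrow> ('o, 'm) cat \<Rightarrow> ('i \<Rightarrow> 'o) \<Rightarrow> ('u \<Rightarrow> 'm) \<Rightarrow> 'o \<Rightarrow> ('i \<Rightarrow> 'm) \<Rightarrow> bool" where
  "is_limit J C Fo Fa L p \<longleftrightarrow> is_cone J C Fo Fa L p \<and>
     (\<forall>M q. is_cone J C Fo Fa M q \<longrightarrow>
        (\<exists>!h. h \<in> hom C M L \<and> (\<forall>i \<in> Obj J. p i \<cdot>\<^bsub>C\<^esub> h = q i)))"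

definition is_cocone ::
  "('i, 'u) cat \<Rightarrow> ('o, 'm) cat \<Rightarrow> ('i \<Rightarrow> 'o) \<Rightarrow> ('u \<Rightarrow> 'm) \<Rightarrow> 'o \<Rightarrow> ('i \<Rightarrow> 'm) \<Rightarrow> bool" where
  "is_cocone J C Fo Fa L p \<longleftrightarrow> L \<in> Obj C \<and>
     (\<forall>i \<in> Obj J. p i \<in> hom C (Fo i) L) \<and>
     (\<forall>u \<in> Arr J. p (Cod J u) \<cdot>\<^bsub>C\<^esub> Fa u = p (Dom J u))"

definition is_colimit ::
  "('i, 'u) cat \<Rightarrow> ('o, 'm) cat \<Rightarrow> ('i \<Rightarrow> 'o) \<Rightarrow> ('u \<Rightarrow> 'm) \<Rightarrow> 'o \<Rightarrow> ('i \<Rightarrow> 'm) \<Rightarrow> bool" where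
  "is_colimit J C Fo Fa L p \<longleftrightarrow> is_cocone J C Fo Fa L p \<and>
     (\<forall>M q. is_cocone J C Fo Fa M q \<longrightarrow>
        (\<exists>!h. h \<in> hom C L M \<and> (\<forall>i \<in> Obj J. h \<cdot>\<^bsub>C\<^esub> p i = q i)))"

text \<open>Every finite category is isomorphic to one whose objects and arrows are natural numbers, so
  these index categories suffice.\<close>

definition finitely_complete :: "('o, 'm) cat \<Rightarrow> bool" where
  "finitely_complete C \<longleftrightarrow>
     (\<forall>(J :: (nat, nat) cat) Fo Fa.
        category J \<and> finite (Obj J) \<and> finite (Arr J) \<and> is_functor J C Fo Fa \<longrightarrow>
        (\<exists>L p. is_limit J C Fo Fa L p))"

definition finitely_cocomplete :: "('o, 'm) cat \<Rightarrow> bool" where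
  "finitely_cocomplete C \<longleftrightarrow>
     (\<forall>(J :: (nat, nat) cat) Fo Fa.
        category J \<and> finite (Obj J) \<and> finite (Arr J) \<and> is_functor J C Fo Fa \<longrightarrow>
        (\<exists>L p. is_colimit J C Fo Fa L p))"

definition is_product :: "('o, 'm) cat \<Rightarrow> 'o \<Rightarrow> 'o \<Rightarrow> 'o \<Rightarrow> 'm \<Rightarrow> 'm \<Rightarrow> bool" where
  "is_product C X Y P p q \<longleftrightarrow> P \<in> Obj C \<and> p \<in> hom C P X \<and> q \<in> hom C P Y \<and>
     (\<forall>T. \<forall>f \<in> hom C T X. \<forall>g \<in> hom C T Y.
        \<exists>!h. h \<in> hom C T P \<and> p \<cdot>\<^bsub>C\<^esub> h = f \<and> q \<cdot>\<^bsub>C\<^esub> h = g)"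

definition is_coproduct :: "('o, 'm) cat \<Rightarrow> 'o \<Rightarrow> 'o \<Rightarrow> 'o \<Rightarrow> 'm \<Rightarrow> 'm \<Rightarrow> bool" where
  "is_coproduct C X Y S i j \<longleftrightarrow> S \<in> Obj C \<and> i \<in> hom C X S \<and> j \<in> hom C Y S \<and>
     (\<forall>T. \<forall>f \<in> hom C X T. \<forall>g \<in> hom C Y T.
        \<exists>!h. h \<in> hom C S T \<and> h \<cdot>\<^bsub>C\<^esub> i = f \<and> h \<cdot>\<^bsub>C\<^esub> j = g)"

definition has_binary_coproducts :: "('o, 'm) cat \<Rightarrow> bool" where
  "has_binary_coproducts C \<longleftrightarrow> (\<forall>X \<in> Obj C. \<forall>Y \<in> Obj C. \<exists>S i j. is_coproduct C X Y S i j)"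

text \<open>In \<open>is_pullback C a b f g\<close> the square is \<open>f \<cdot> a = g \<cdot> b\<close>: the arrow \<open>b\<close> is the pullback of
  \<open>f\<close> along \<open>g\<close>, and \<open>a\<close> the pullback of \<open>g\<close> along \<open>f\<close>.\<close>

definition is_pullback :: "('o, 'm) cat \<Rightarrow> 'm \<Rightarrow> 'm \<Rightarrow> 'm \<Rightarrow> 'm \<Rightarrow> bool" where
  "is_pullback C a b f g \<longleftrightarrow>
     f \<in> Arr C \<and> g \<in> hom C (Dom C g) (Cod C f) \<and>
     a \<in> hom C (Dom C a) (Dom C f) \<and> b \<in> hom C (Dom C a) (Dom C g) \<and>
     f \<cdot>\<^bsub>C\<^esub> a = g \<cdot>\<^bsub>C\<^esub> b \<and>
     (\<forall>T. \<forall>s \<in> hom C T (Dom C f). \<forall>t \<in> hom C T (Dom C g).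
        f \<cdot>\<^bsub>C\<^esub> s = g \<cdot>\<^bsub>C\<^esub> t \<longrightarrow>
        (\<exists>!h. h \<in> hom C T (Dom C a) \<and> a \<cdot>\<^bsub>C\<^esub> h = s \<and> b \<cdot>\<^bsub>C\<^esub> h = t))"

definition is_kernel_pair :: "('o, 'm) cat \<Rightarrow> 'm \<Rightarrow> 'm \<Rightarrow> 'm \<Rightarrow> bool" where
  "is_kernel_pair C r s f \<longleftrightarrow> is_pullback C r s f f"

definition is_coequalizer :: "('o, 'm) cat \<Rightarrow> 'm \<Rightarrow> 'm \<Rightarrow> 'm \<Rightarrow> bool" where
  "is_coequalizer C e u v \<longleftrightarrow>
     u \<in> Arr C \<and> v \<in> hom C (Dom C u) (Cod C u) \<and> e \<in> hom C (Cod C u) (Cod C e) \<and>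
     e \<cdot>\<^bsub>C\<^esub> u = e \<cdot>\<^bsub>C\<^esub> v \<and>
     (\<forall>T. \<forall>f \<in> hom C (Cod C u) T. f \<cdot>\<^bsub>C\<^esub> u = f \<cdot>\<^bsub>C\<^esub> v \<longrightarrow>
        (\<exists>!h. h \<in> hom C (Cod C e) T \<and> h \<cdot>\<^bsub>C\<^esub> e = f))"

definition regular_epi :: "('o, 'm) cat \<Rightarrow> 'm \<Rightarrow> bool" where
  "regular_epi C e \<longleftrightarrow> (\<exists>u v. is_coequalizer C e u v)"


section \<open>Pointed categories\<close>

definition is_terminal :: "('o, 'm) cat \<Rightarrow> 'o \<Rightarrow> bool" where
  "is_terminal C z \<longleftrightarrow> z \<in> Obj C \<and> (\<forall>a \<in> Obj C. \<exists>!f. f \<in> hom C a z)"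

definition is_initial :: "('o, 'm) cat \<Rightarrow> 'o \<Rightarrow> bool" where
  "is_initial C z \<longleftrightarrow> z \<in> Obj C \<and> (\<forall>a \<in> Obj C. \<exists>!f. f \<in> hom C z a)"

definition is_zero :: "('o, 'm) cat \<Rightarrow> 'o \<Rightarrow> bool" where
  "is_zero C z \<longleftrightarrow> is_initial C z \<and> is_terminal C z"

definition pointed :: "('o, 'm) cat \<Rightarrow> bool" where
  "pointed C \<longleftrightarrow> (\<exists>z. is_zero C z)"

definition zero_arr :: "('o, 'm) cat \<Rightarrow> 'o \<Rightarrow> 'o \<Rightarrow> 'm" where
  "zero_arr C a b =
     (THE f. \<exists>z g h. is_zero C z \<and> g \<in> hom C a z \<and> h \<in> hom C z b \<and> f = h \<cdot>\<^bsub>C\<^esub> g)"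

definition is_kernel :: "('o, 'm) cat \<Rightarrow> 'm \<Rightarrow> 'm \<Rightarrow> bool" where
  "is_kernel C k f \<longleftrightarrow>
     f \<in> Arr C \<and> k \<in> hom C (Dom C k) (Dom C f) \<and>
     f \<cdot>\<^bsub>C\<^esub> k = zero_arr C (Dom C k) (Cod C f) \<and>
     (\<forall>T. \<forall>t \<in> hom C T (Dom C f). f \<cdot>\<^bsub>C\<^esub> t = zero_arr C T (Cod C f) \<longrightarrow>
        (\<exists>!h. h \<in> hom C T (Dom C k) \<and> k \<cdot>\<^bsub>C\<^esub> h = t))"


section \<open>Homological and semi-abelian categories\<close>

definition regular :: "('o, 'm) cat \<Rightarrow> bool" where
  "regular C \<longleftrightarrow> finitely_complete C \<and>
     (\<forall>r s f. is_kernel_pair C r s f \<longrightarrow> (\<exists>e. is_coequalizer C e r s)) \<and>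
     (\<forall>a b f g. is_pullback C a b f g \<and> regular_epi C f \<longrightarrow> regular_epi C b)"

text \<open>Protomodularity in the sense of Bourn: every change-of-base functor between categories of
  points reflects isomorphisms. A point over \<open>B\<close> is a split epimorphism with codomain \<open>B\<close> together
  with a chosen section.\<close>

definition is_point :: "('o, 'm) cat \<Rightarrow> 'o \<Rightarrow> 'm \<Rightarrow> 'm \<Rightarrow> bool" where
  "is_point C B p s \<longleftrightarrow> B \<in> Obj C \<and> p \<in> hom C (Dom C p) B \<and> s \<in> hom C B (Dom C p) \<and>
     p \<cdot>\<^bsub>C\<^esub> s = Ident C B"

definition is_point_map ::
  "('o, 'm) cat \<Rightarrow> 'm \<Rightarrow> 'm \<Rightarrow> 'm \<Rightarrow> 'm \<Rightarrow> 'm \<Rightarrow> bool" where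
  "is_point_map C p s q t f \<longleftrightarrow> f \<in> hom C (Dom C p) (Dom C q) \<and>
     q \<cdot>\<^bsub>C\<^esub> f = p \<and> f \<cdot>\<^bsub>C\<^esub> s = t"

text \<open>Below, \<open>p'\<close> and \<open>q'\<close> are the pullbacks of \<open>p\<close> and \<open>q\<close> along \<open>v\<close>, and \<open>f'\<close> is the arrow induced
  by \<open>f\<close> between them. Such an \<open>f'\<close> automatically preserves the induced sections, and a point map
  is invertible as such exactly when its underlying arrow is, so sections of \<open>p'\<close> and \<open>q'\<close> need
  not be mentioned.\<close>

definition protomodular :: "('o, 'm) cat \<Rightarrow> bool" where
  "protomodular C \<longleftrightarrow>
     (\<forall>B v p s q t f a p' d q' f'.
        is_point C B p s \<and> is_point C B q t \<and> is_point_map C p s q t f \<and>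
        is_pullback C a p' p v \<and> is_pullback C d q' q v \<and>
        f' \<in> hom C (Dom C a) (Dom C d) \<and>
        d \<cdot>\<^bsub>C\<^esub> f' = f \<cdot>\<^bsub>C\<^esub> a \<and> q' \<cdot>\<^bsub>C\<^esub> f' = p' \<and> iso C f' \<longrightarrow>
        iso C f)"

definition homological :: "('o, 'm) cat \<Rightarrow> bool" where
  "homological C \<longleftrightarrow> pointed C \<and> finitely_complete C \<and> regular C \<and> protomodular C"

definition is_equivalence_relation :: "('o, 'm) cat \<Rightarrow> 'o \<Rightarrow> 'o \<Rightarrow> 'm \<Rightarrow> 'm \<Rightarrow> bool" where
  "is_equivalence_relation C X R r s \<longleftrightarrow>
     X \<in> Obj C \<and> r \<in> hom C R X \<and> s \<in> hom C R X \<and>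
     (\<forall>T. \<forall>g \<in> hom C T R. \<forall>h \<in> hom C T R.
        r \<cdot>\<^bsub>C\<^esub> g = r \<cdot>\<^bsub>C\<^esub> h \<and> s \<cdot>\<^bsub>C\<^esub> g = s \<cdot>\<^bsub>C\<^esub> h \<longrightarrow> g = h) \<and>
     (\<exists>d \<in> hom C X R. r \<cdot>\<^bsub>C\<^esub> d = Ident C X \<and> s \<cdot>\<^bsub>C\<^esub> d = Ident C X) \<and>
     (\<exists>w \<in> hom C R R. r \<cdot>\<^bsub>C\<^esub> w = s \<and> s \<cdot>\<^bsub>C\<^esub> w = r) \<and>
     (\<forall>a b. is_pullback C a b s r \<longrightarrow>
        (\<exists>c \<in> hom C (Dom C a) R.
           r \<cdot>\<^bsub>C\<^esub> c = r \<cdot>\<^bsub>C\<^esub> a \<and> s \<cdot>\<^bsub>C\<^esub> c = s \<cdot>\<^bsub>C\<^esub> b))"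

definition barr_exact :: "('o, 'm) cat \<Rightarrow> bool" where
  "barr_exact C \<longleftrightarrow> regular C \<and>
     (\<forall>X R r s. is_equivalence_relation C X R r s \<longrightarrow> (\<exists>f. is_kernel_pair C r s f))"

definition semi_abelian :: "('o, 'm) cat \<Rightarrow> bool" where
  "semi_abelian C \<longleftrightarrow> pointed C \<and> has_binary_coproducts C \<and> protomodular C \<and> barr_exact C"


section \<open>Co-smash products, conjugation and commutators\<close>

text \<open>Products, coproducts, kernels and images are determined only up to isomorphism; a fixed
  choice is made of each. These operations are meaningful in finitely cocomplete homological
  categories, where the chosen objects exist.\<close>

definition product :: "('o, 'm) cat \<Rightarrow> 'o \<Rightarrow> 'o \<Rightarrow> 'o \<times> 'm \<times> 'm" where
  "product C X Y = (SOME (P, p, q). is_product C X Y P p q)"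

definition prod_obj :: "('o, 'm) cat \<Rightarrow> 'o \<Rightarrow> 'o \<Rightarrow> 'o" where
  "prod_obj C X Y = fst (product C X Y)"

definition proj1 :: "('o, 'm) cat \<Rightarrow> 'o \<Rightarrow> 'o \<Rightarrow> 'm" where
  "proj1 C X Y = fst (snd (product C X Y))"

definition proj2 :: "('o, 'm) cat \<Rightarrow> 'o \<Rightarrow> 'o \<Rightarrow> 'm" where
  "proj2 C X Y = snd (snd (product C X Y))"

definition pair :: "('o, 'm) cat \<Rightarrow> 'm \<Rightarrow> 'm \<Rightarrow> 'm" where
  "pair C f g = (THE h. h \<in> hom C (Dom C f) (prod_obj C (Cod C f) (Cod C g)) \<and>
     proj1 C (Cod C f) (Cod C g) \<cdot>\<^bsub>C\<^esub> h = f \<and> proj2 C (Cod C f) (Cod C g) \<cdot>\<^bsub>C\<^esub> h = g)"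

definition coproduct :: "('o, 'm) cat \<Rightarrow> 'o \<Rightarrow> 'o \<Rightarrow> 'o \<times> 'm \<times> 'm" where
  "coproduct C X Y = (SOME (S, i, j). is_coproduct C X Y S i j)"

definition coprod_obj :: "('o, 'm) cat \<Rightarrow> 'o \<Rightarrow> 'o \<Rightarrow> 'o" where
  "coprod_obj C X Y = fst (coproduct C X Y)"

definition inj1 :: "('o, 'm) cat \<Rightarrow> 'o \<Rightarrow> 'o \<Rightarrow> 'm" where
  "inj1 C X Y = fst (snd (coproduct C X Y))"

definition inj2 :: "('o, 'm) cat \<Rightarrow> 'o \<Rightarrow> 'o \<Rightarrow> 'm" where
  "inj2 C X Y = snd (snd (coproduct C X Y))"

definition copair :: "('o, 'm) cat \<Rightarrow> 'm \<Rightarrow> 'm \<Rightarrow> 'm" where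
  "copair C f g = (THE h. h \<in> hom C (coprod_obj C (Dom C f) (Dom C g)) (Cod C f) \<and>
     h \<cdot>\<^bsub>C\<^esub> inj1 C (Dom C f) (Dom C g) = f \<and> h \<cdot>\<^bsub>C\<^esub> inj2 C (Dom C f) (Dom C g) = g)"

text \<open>The arrow \<open>f + g\<close>.\<close>

definition coprod_map :: "('o, 'm) cat \<Rightarrow> 'm \<Rightarrow> 'm \<Rightarrow> 'm" where
  "coprod_map C f g =
     copair C (inj1 C (Cod C f) (Cod C g) \<cdot>\<^bsub>C\<^esub> f) (inj2 C (Cod C f) (Cod C g) \<cdot>\<^bsub>C\<^esub> g)"

text \<open>The canonical arrow \<open>X + Y \<rightarrow> X \<times> Y\<close>, with components \<open>\<langle>1, 0\<rangle>\<close> and \<open>\<langle>0, 1\<rangle>\<close>.\<close>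

definition coprod_to_prod :: "('o, 'm) cat \<Rightarrow> 'o \<Rightarrow> 'o \<Rightarrow> 'm" where
  "coprod_to_prod C X Y =
     copair C (pair C (Ident C X) (zero_arr C X Y)) (pair C (zero_arr C Y X) (Ident C Y))"

text \<open>\<open>cosmash C X Y\<close> is the object \<open>(X|Y)\<close>, and \<open>cosmash_incl C X Y\<close> its inclusion \<open>\<iota>\<close> into
  \<open>X + Y\<close>; \<open>cosmash_map C f g\<close> is \<open>(f|g)\<close>.\<close>

definition cosmash_incl :: "('o, 'm) cat \<Rightarrow> 'o \<Rightarrow> 'o \<Rightarrow> 'm" where
  "cosmash_incl C X Y = (SOME k. is_kernel C k (coprod_to_prod C X Y))"

definition cosmash :: "('o, 'm) cat \<Rightarrow> 'o \<Rightarrow> 'o \<Rightarrow> 'o" where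
  "cosmash C X Y = Dom C (cosmash_incl C X Y)"

definition cosmash_map :: "('o, 'm) cat \<Rightarrow> 'm \<Rightarrow> 'm \<Rightarrow> 'm" where
  "cosmash_map C f g =
     (THE h. h \<in> hom C (cosmash C (Dom C f) (Dom C g)) (cosmash C (Cod C f) (Cod C g)) \<and>
        cosmash_incl C (Cod C f) (Cod C g) \<cdot>\<^bsub>C\<^esub> h =
        coprod_map C f g \<cdot>\<^bsub>C\<^esub> cosmash_incl C (Dom C f) (Dom C g))"

text \<open>The conjugation action \<open>(A|A) \<rightarrow> A\<close> of \<open>A\<close> on itself.\<close>

definition conj_action :: "('o, 'm) cat \<Rightarrow> 'o \<Rightarrow> 'm" where
  "conj_action C A = copair C (Ident C A) (Ident C A) \<cdot>\<^bsub>C\<^esub> cosmash_incl C A A"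

text \<open>Subobjects are represented by monomorphisms; all the predicates below are invariant under
  isomorphism of subobjects.\<close>

definition is_subobject :: "('o, 'm) cat \<Rightarrow> 'm \<Rightarrow> 'o \<Rightarrow> bool" where
  "is_subobject C x A \<longleftrightarrow> monic C x \<and> Cod C x = A"

definition factors_through :: "('o, 'm) cat \<Rightarrow> 'm \<Rightarrow> 'm \<Rightarrow> bool" where
  "factors_through C f x \<longleftrightarrow> (\<exists>h \<in> hom C (Dom C f) (Dom C x). x \<cdot>\<^bsub>C\<^esub> h = f)"

text \<open>Inclusion of subobjects of a common object.\<close>

definition subobject_le :: "('o, 'm) cat \<Rightarrow> 'm \<Rightarrow> 'm \<Rightarrow> bool" where
  "subobject_le C x y \<longleftrightarrow> factors_through C x y"

definition is_image :: "('o, 'm) cat \<Rightarrow> 'm \<Rightarrow> 'm \<Rightarrow> bool" where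
  "is_image C m f \<longleftrightarrow> is_subobject C m (Cod C f) \<and>
     (\<exists>e \<in> hom C (Dom C f) (Dom C m). regular_epi C e \<and> m \<cdot>\<^bsub>C\<^esub> e = f)"

definition image :: "('o, 'm) cat \<Rightarrow> 'm \<Rightarrow> 'm" where
  "image C f = (SOME m. is_image C m f)"

definition proper :: "('o, 'm) cat \<Rightarrow> 'm \<Rightarrow> bool" where
  "proper C x \<longleftrightarrow> (\<exists>f. is_kernel C x f)"

text \<open>For \<open>x\<close> and \<open>y\<close> with common codomain \<open>A\<close>, \<open>commutator C x y\<close> represents the subobject
  \<open>[X,Y]\<close> of \<open>A\<close>.\<close>

definition commutator :: "('o, 'm) cat \<Rightarrow> 'm \<Rightarrow> 'm \<Rightarrow> 'm" where
  "commutator C x y = image C (conj_action C (Cod C x) \<cdot>\<^bsub>C\<^esub> cosmash_map C x y)"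

definition stable_under_conj :: "('o, 'm) cat \<Rightarrow> 'm \<Rightarrow> bool" where
  "stable_under_conj C x \<longleftrightarrow>
     factors_through C
       (conj_action C (Cod C x) \<cdot>\<^bsub>C\<^esub> cosmash_map C x (Ident C (Cod C x))) x"

end

theory Submission imports Defs begin

text \<open>If \<open>x : X \<rightarrow> A\<close> is stable under conjugation, the reflexive relation on \<open>A\<close> generated by the
  pairs \<open>(0, x)\<close> has zero class \<open>X\<close>. Protomodularity makes every reflexive relation an equivalence
  relation, so exactness turns it into the kernel pair of some \<open>f\<close>, and \<open>x\<close> is the kernel of \<open>f\<close>.
  Conversely the zero class of an equivalence relation is always stable under conjugation; if it is
  the kernel of some \<open>f\<close>, the relation is the kernel pair of \<open>f\<close>, since protomodularity determines a
  reflexive relation by its zero class.\<close>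

section \<open>Categories with finite limits\<close>

text \<open>Why conjugation decides the zero class: the relation generated by \<open>(0, x)\<close>
  is an image of \<open>X + A\<close> in \<open>A \<times> A\<close>, so its zero class is the image
  under \<open>[x, 1]\<close> of the kernel of \<open>[0, 1] : X + A \<rightarrow> A\<close>. In
  groups that kernel is the normal closure of \<open>X\<close> in \<open>X + A\<close>; in general
  it is generated by \<open>X\<close> and \<open>(X|A)\<close>. Stability says precisely that
  \<open>[x, 1]\<close> sends \<open>(X|A)\<close> into \<open>X\<close>, so the zero class cannot
  outgrow \<open>X\<close>. Because the relation is an image, its generalized elements lift to
  \<open>X + A\<close> only after passing to a cover, and the conclusions must be descended again.

  Protomodularity does its work through one principle, \<open>point_related\<close>: a relation that
  holds on the section of a point and on a pullback of the point holds on the whole point. The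
  relation is a parameter. Taking \<open>(x, x)\<close> for a monic \<open>x\<close> proves
  membership in a subobject, taking two identities proves that two arrows are equal, and taking a
  given relation proves difunctionality or an inclusion of relations.\<close>

context category
begin

lemma homD:
  assumes "f \<in> hom C a b"
  shows "f \<in> Arr C" "Dom C f = a" "Cod C f = b" "a \<in> Obj C" "b \<in> Obj C"
  using assms Dom_in_Obj Cod_in_Obj by (auto simp: hom_def)

lemma Comp_simps [simp]:
  assumes "f \<in> Arr C" "g \<in> Arr C" "Cod C f = Dom C g"
  shows "g \<cdot> f \<in> Arr C" "Dom C (g \<cdot> f) = Dom C f" "Cod C (g \<cdot> f) = Cod C g"
  using Comp_in_hom[of f "Dom C f" "Dom C g" g "Cod C g"] assms by (auto simp: hom_def)

lemma Ident_simps [simp]: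
  assumes "a \<in> Obj C"
  shows "Ident C a \<in> Arr C" "Dom C (Ident C a) = a" "Cod C (Ident C a) = a"
  using Ident_in_hom[OF assms] by (auto simp: hom_def)

lemma assoc:
  assumes "f \<in> Arr C" "g \<in> Arr C" "h \<in> Arr C" "Cod C f = Dom C g" "Cod C g = Dom C h"
  shows "(h \<cdot> g) \<cdot> f = h \<cdot> (g \<cdot> f)"
  using Comp_assoc[of f "Dom C f" "Dom C g" g "Dom C h" h "Cod C h"] assms by (auto simp: hom_def)

text \<open>Associativity holds only for composable arrows, so it is no unconditional rewrite rule.
  This form carries a known equation past a further precomposition in one instantiation.\<close>

lemma Comp_reassoc:
  assumes "g \<cdot> f = w" "h \<in> hom C t a" "f \<in> hom C a b" "g \<in> hom C b c"
  shows "g \<cdot> (f \<cdot> h) = w \<cdot> h"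
  using Comp_assoc[OF assms(2-4)] assms(1) by simp

lemma monic_cancel:
  assumes "monic C m" "m \<in> hom C a b" "g \<in> hom C t a" "h \<in> hom C t a" "m \<cdot> g = m \<cdot> h"
  shows "g = h"
  using assms by (auto simp: monic_def hom_def)

lemma iso_inverse:
  assumes "iso C f" "f \<in> hom C a b"
  obtains g where "g \<in> hom C b a" "g \<cdot> f = Ident C a" "f \<cdot> g = Ident C b"
  using assms by (auto simp: iso_def hom_def)

lemma iso_Ident: "a \<in> Obj C \<Longrightarrow> iso C (Ident C a)"
  unfolding iso_def
  by (auto intro!: bexI[of _ "Ident C a"] simp: Ident_in_hom Comp_Ident_left[OF Ident_in_hom])

lemma pullbackD:
  assumes "is_pullback C a b f g" "a \<in> hom C p x" "f \<in> hom C x z" "g \<in> hom C y z"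
  shows "b \<in> hom C p y" "f \<cdot> a = g \<cdot> b"
  using assms by (auto simp: is_pullback_def hom_def)

lemma pullback_ex1:
  assumes "is_pullback C a b f g" "a \<in> hom C p x" "f \<in> hom C x z" "g \<in> hom C y z"
    and "s \<in> hom C t x" "u \<in> hom C t y" "f \<cdot> s = g \<cdot> u"
  shows "\<exists>!h. h \<in> hom C t p \<and> a \<cdot> h = s \<and> b \<cdot> h = u"
proof -
  have "\<forall>t. \<forall>s \<in> hom C t x. \<forall>u \<in> hom C t y. f \<cdot> s = g \<cdot> u \<longrightarrow>
      (\<exists>!h. h \<in> hom C t p \<and> a \<cdot> h = s \<and> b \<cdot> h = u)"
    using assms(1) homD(2)[OF assms(2)] homD(2)[OF assms(3)] homD(2)[OF assms(4)]
    unfolding is_pullback_def by simp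
  then show ?thesis
    using assms(5-7) by blast
qed

lemma pullback_lift:
  assumes "is_pullback C a b f g" "a \<in> hom C p x" "f \<in> hom C x z" "g \<in> hom C y z"
    and "s \<in> hom C t x" "u \<in> hom C t y" "f \<cdot> s = g \<cdot> u"
  obtains h where "h \<in> hom C t p" "a \<cdot> h = s" "b \<cdot> h = u"
  using pullback_ex1[OF assms] by blast

lemma pullback_unique:
  assumes "is_pullback C a b f g" "a \<in> hom C p x" "f \<in> hom C x z" "g \<in> hom C y z"
    and "h \<in> hom C t p" "k \<in> hom C t p" "a \<cdot> h = a \<cdot> k" "b \<cdot> h = b \<cdot> k"
  shows "h = k"
proof -
  note b = pullbackD[OF assms(1-4)]
  have 1: "a \<cdot> k \<in> hom C t x" "b \<cdot> k \<in> hom C t y"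
    using assms(2,6) b(1) Comp_in_hom by blast+
  have "f \<cdot> (a \<cdot> k) = g \<cdot> (b \<cdot> k)"
    using Comp_assoc[OF assms(6,2,3)] Comp_assoc[OF assms(6) b(1) assms(4)] b(2) by simp
  then have "\<exists>!h. h \<in> hom C t p \<and> a \<cdot> h = a \<cdot> k \<and> b \<cdot> h = b \<cdot> k"
    using pullback_ex1[OF assms(1-4) 1] by simp
  then show ?thesis
    using assms(5-8) by metis
qed

lemma pullbackI:
  assumes "f \<in> hom C x z" "g \<in> hom C y z" "a \<in> hom C p x" "b \<in> hom C p y" "f \<cdot> a = g \<cdot> b"
    and "\<And>t s u. s \<in> hom C t x \<Longrightarrow> u \<in> hom C t y \<Longrightarrow> f \<cdot> s = g \<cdot> u \<Longrightarrow>
      \<exists>!h. h \<in> hom C t p \<and> a \<cdot> h = s \<and> b \<cdot> h = u"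
  shows "is_pullback C a b f g"
  using assms unfolding is_pullback_def by (simp add: hom_def)

text \<open>The shape \<open>0 \<rightarrow> 2 \<leftarrow> 1\<close>. Each object is its own
  identity arrow, 3 and 4 are the two legs, and \<open>v < 3\<close> tests for an identity: in a
  composable pair at least one factor is an identity.\<close>

definition cospan :: "(nat, nat) cat" where
  "cospan = \<lparr>Obj = {0, 1, 2}, Arr = {0, 1, 2, 3, 4},
     Dom = (\<lambda>u. if u = 3 then 0 else if u = 4 then 1 else u),
     Cod = (\<lambda>u. if 3 \<le> u then 2 else u), Ident = (\<lambda>i. i),
     Comp = (\<lambda>v u. if v < 3 then u else v)\<rparr>"

text \<open>The discrete category on two objects, each serving as its own identity. Composable
  arrows coincide, so either factor may be returned. Its limits are products and its colimits
  coproducts.\<close>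

definition two :: "(nat, nat) cat" where
  "two = \<lparr>Obj = {0, 1}, Arr = {0, 1}, Dom = (\<lambda>u. u), Cod = (\<lambda>u. u), Ident = (\<lambda>i. i),
     Comp = (\<lambda>v u. u)\<rparr>"

lemma category_cospan: "Defs.category cospan"
  by unfold_locales (auto simp: cospan_def hom_def split: if_splits)

lemma category_two: "Defs.category two"
  by unfold_locales (auto simp: two_def hom_def)

lemma pullback_exists:
  assumes "finitely_complete C" "f \<in> hom C x z" "g \<in> hom C y z"
  obtains p a b where "a \<in> hom C p x" "b \<in> hom C p y" "is_pullback C a b f g"
proof -
  define Fo where "Fo = (\<lambda>i::nat. if i = 0 then x else if i = 1 then y else z)"
  define Fa where "Fa = (\<lambda>u::nat. if u = 3 then f else if u = 4 then g else Ident C (Fo u))"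
  note xyz = homD(4,5)[OF assms(2)] homD(4,5)[OF assms(3)]
  have "is_functor cospan C Fo Fa"
    using assms(2,3) xyz
    by (auto simp: is_functor_def cospan_def Fo_def Fa_def Ident_in_hom
        Comp_Ident_right Comp_Ident_left Comp_Ident_left[OF Ident_in_hom])
  moreover have "finite (Obj cospan)" "finite (Arr cospan)"
    by (auto simp: cospan_def)
  ultimately obtain L p where lim: "is_limit cospan C Fo Fa L p"
    using assms(1) category_cospan unfolding finitely_complete_def by blast
  then have cone: "is_cone cospan C Fo Fa L p"
    by (simp add: is_limit_def)
  then have p: "p 0 \<in> hom C L x" "p 1 \<in> hom C L y" "f \<cdot> p 0 = p 2" "g \<cdot> p 1 = p 2"
    by (auto simp: is_cone_def cospan_def Fo_def Fa_def)
  have "is_pullback C (p 0) (p 1) f g"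
  proof (rule pullbackI[OF assms(2,3) p(1,2)])
    show "f \<cdot> p 0 = g \<cdot> p 1"
      using p by simp
    fix t s u
    assume st: "s \<in> hom C t x" "u \<in> hom C t y" "f \<cdot> s = g \<cdot> u"
    define q where "q = (\<lambda>i::nat. if i = 0 then s else if i = 1 then u else f \<cdot> s)"
    have "is_cone cospan C Fo Fa t q"
      using st assms(2,3) homD(4)[OF st(1)] Comp_in_hom[OF st(1) assms(2)]
      by (auto simp: is_cone_def cospan_def Fo_def Fa_def q_def Comp_Ident_left)
    then have "\<exists>!h. h \<in> hom C t L \<and> (\<forall>i \<in> Obj cospan. p i \<cdot> h = q i)"
      using lim unfolding is_limit_def by blast
    then have ex1: "\<exists>!h. h \<in> hom C t L \<and> (\<forall>i \<in> {0, 1, 2}. p i \<cdot> h = q i)"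
      by (simp only: cospan_def cat.simps)
    \<comment> \<open>The leg at the vertex 2 is determined by the leg at 0, so the universal
      property of the limit cone reduces to the two equations of a pullback.\<close>
    have "p 2 \<cdot> h = f \<cdot> s" if "h \<in> hom C t L" "p 0 \<cdot> h = s" for h
      using Comp_assoc[OF that(1) p(1) assms(2)] that p(3) by simp
    then have "(h \<in> hom C t L \<and> (\<forall>i \<in> {0, 1, 2}. p i \<cdot> h = q i)) \<longleftrightarrow>
        (h \<in> hom C t L \<and> p 0 \<cdot> h = s \<and> p 1 \<cdot> h = u)" for h
      by (auto simp: q_def)
    then show "\<exists>!h. h \<in> hom C t L \<and> p 0 \<cdot> h = s \<and> p 1 \<cdot> h = u"
      using ex1 by simp
  qed
  then show thesis
    using that p by blast
qed

lemma functor_two: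
  assumes "x \<in> Obj C" "y \<in> Obj C"
  shows "is_functor two C (\<lambda>i. if i = 0 then x else y) (\<lambda>i. Ident C (if i = 0 then x else y))"
  using assms by (auto simp: is_functor_def two_def Ident_in_hom Comp_Ident_left[OF Ident_in_hom])

lemma product_exists:
  assumes "finitely_complete C" "x \<in> Obj C" "y \<in> Obj C"
  shows "\<exists>P p q. is_product C x y P p q"
proof -
  define Fo where "Fo = (\<lambda>i::nat. if i = 0 then x else y)"
  define Fa where "Fa = (\<lambda>i::nat. Ident C (if i = 0 then x else y))"
  have "finite (Obj two)" "finite (Arr two)"
    by (auto simp: two_def)
  then obtain L p where lim: "is_limit two C Fo Fa L p"
    using assms category_two functor_two[OF assms(2,3)]
    unfolding finitely_complete_def Fo_def Fa_def by blast
  then have p: "L \<in> Obj C" "p 0 \<in> hom C L x" "p 1 \<in> hom C L y"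
    by (auto simp: is_limit_def is_cone_def two_def Fo_def)
  have "\<exists>!h. h \<in> hom C t L \<and> p 0 \<cdot> h = f \<and> p 1 \<cdot> h = g"
    if fg: "f \<in> hom C t x" "g \<in> hom C t y" for t f g
  proof -
    have "is_cone two C Fo Fa t (\<lambda>i. if i = 0 then f else g)"
      using fg homD(4)[OF fg(1)]
      by (auto simp: is_cone_def two_def Fo_def Fa_def Comp_Ident_left)
    then have "\<exists>!h. h \<in> hom C t L \<and> (\<forall>i \<in> Obj two. p i \<cdot> h = (if i = 0 then f else g))"
      using lim unfolding is_limit_def by blast
    then show ?thesis
      by (simp add: two_def)
  qed
  then show ?thesis
    using p unfolding is_product_def by blast
qed

lemma coproduct_exists:
  assumes "finitely_cocomplete C" "x \<in> Obj C" "y \<in> Obj C"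
  shows "\<exists>S i j. is_coproduct C x y S i j"
proof -
  define Fo where "Fo = (\<lambda>i::nat. if i = 0 then x else y)"
  define Fa where "Fa = (\<lambda>i::nat. Ident C (if i = 0 then x else y))"
  have "finite (Obj two)" "finite (Arr two)"
    by (auto simp: two_def)
  then obtain L p where lim: "is_colimit two C Fo Fa L p"
    using assms category_two functor_two[OF assms(2,3)]
    unfolding finitely_cocomplete_def Fo_def Fa_def by blast
  then have p: "L \<in> Obj C" "p 0 \<in> hom C x L" "p 1 \<in> hom C y L"
    by (auto simp: is_colimit_def is_cocone_def two_def Fo_def)
  have "\<exists>!h. h \<in> hom C L t \<and> h \<cdot> p 0 = f \<and> h \<cdot> p 1 = g"
    if fg: "f \<in> hom C x t" "g \<in> hom C y t" for t f g
  proof -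
    have "is_cocone two C Fo Fa t (\<lambda>i. if i = 0 then f else g)"
      using fg homD(5)[OF fg(1)]
      by (auto simp: is_cocone_def two_def Fo_def Fa_def Comp_Ident_right)
    then have "\<exists>!h. h \<in> hom C L t \<and> (\<forall>i \<in> Obj two. h \<cdot> p i = (if i = 0 then f else g))"
      using lim unfolding is_colimit_def by blast
    then show ?thesis
      by (simp add: two_def)
  qed
  then show ?thesis
    using p unfolding is_coproduct_def by blast
qed

section \<open>Regular epimorphisms and images\<close>

lemma regular_epiD:
  assumes "regular_epi C e" "e \<in> hom C a b"
  obtains c u v where "u \<in> hom C c a" "v \<in> hom C c a" "e \<cdot> u = e \<cdot> v"
    "\<forall>t. \<forall>f \<in> hom C a t. f \<cdot> u = f \<cdot> v \<longrightarrow> (\<exists>!h. h \<in> hom C b t \<and> h \<cdot> e = f)"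
proof -
  obtain u v where uv: "is_coequalizer C e u v"
    using assms by (auto simp: regular_epi_def)
  then have a: "Cod C u = a" and b: "Cod C e = b"
    using assms(2) by (auto simp: is_coequalizer_def hom_def)
  show thesis
  proof (rule that)
    show "u \<in> hom C (Dom C u) a" "v \<in> hom C (Dom C u) a"
      using uv a by (auto simp: is_coequalizer_def hom_def)
  qed (use uv in \<open>simp_all add: is_coequalizer_def a b\<close>)
qed

lemma regular_epi_cancel:
  assumes "regular_epi C e" "e \<in> hom C a b" "g \<in> hom C b t" "h \<in> hom C b t" "g \<cdot> e = h \<cdot> e"
  shows "g = h"
proof -
  obtain c u v where uv: "u \<in> hom C c a" "v \<in> hom C c a" "e \<cdot> u = e \<cdot> v"
    "\<forall>t. \<forall>f \<in> hom C a t. f \<cdot> u = f \<cdot> v \<longrightarrow> (\<exists>!h. h \<in> hom C b t \<and> h \<cdot> e = f)"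
    using regular_epiD[OF assms(1,2)] .
  have "(h \<cdot> e) \<cdot> u = (h \<cdot> e) \<cdot> v"
    using Comp_assoc[OF uv(1) assms(2,4)] Comp_assoc[OF uv(2) assms(2,4)] uv(3) by simp
  then show ?thesis
    using uv(4) Comp_in_hom[OF assms(2,4)] assms(3-5) by metis
qed

text \<open>The arrow \<open>h\<close> inherits from \<open>l \<cdot> e\<close> the equation on the
  parallel pair that \<open>e\<close> coequalizes, because \<open>x\<close> is monic; hence
  \<open>h\<close> descends along \<open>e\<close>. This is how a factorization through a subobject
  found on a cover is brought back down.\<close>

lemma regular_epi_monic_diagonal:
  assumes "regular_epi C e" "e \<in> hom C a b" "monic C x" "x \<in> hom C c d"
    and "l \<in> hom C b d" "h \<in> hom C a c" "l \<cdot> e = x \<cdot> h"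
  obtains k where "k \<in> hom C b c" "x \<cdot> k = l"
proof -
  obtain w u v where uv: "u \<in> hom C w a" "v \<in> hom C w a" "e \<cdot> u = e \<cdot> v"
    "\<forall>t. \<forall>f \<in> hom C a t. f \<cdot> u = f \<cdot> v \<longrightarrow> (\<exists>!h. h \<in> hom C b t \<and> h \<cdot> e = f)"
    using regular_epiD[OF assms(1,2)] .
  have "x \<cdot> (h \<cdot> u) = l \<cdot> (e \<cdot> u)" "x \<cdot> (h \<cdot> v) = l \<cdot> (e \<cdot> v)"
    using Comp_assoc[OF uv(1) assms(2,5)] Comp_assoc[OF uv(2) assms(2,5)]
      Comp_assoc[OF uv(1) assms(6,4)] Comp_assoc[OF uv(2) assms(6,4)] assms(7) by simp_all
  then have "h \<cdot> u = h \<cdot> v"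
    using uv(3) monic_cancel[OF assms(3,4) Comp_in_hom[OF uv(1) assms(6)] Comp_in_hom[OF uv(2) assms(6)]]
    by simp
  then obtain k where k: "k \<in> hom C b c" "k \<cdot> e = h"
    using uv(4) assms(6) by blast
  have "(x \<cdot> k) \<cdot> e = l \<cdot> e"
    using Comp_assoc[OF assms(2) k(1) assms(4)] k(2) assms(7) by simp
  then have "x \<cdot> k = l"
    using regular_epi_cancel[OF assms(1,2) Comp_in_hom[OF k(1) assms(4)] assms(5)] by simp
  then show thesis
    using that k by blast
qed

text \<open>In terms of generalized elements: \<open>g\<close> lifts along the regular epimorphism
  \<open>f\<close> after passing to the cover \<open>b\<close>.\<close>

lemma regular_pullback_regular_epi:
  assumes "regular C" "regular_epi C f" "f \<in> hom C x z" "g \<in> hom C y z"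
  obtains p a b where "a \<in> hom C p x" "b \<in> hom C p y" "f \<cdot> a = g \<cdot> b" "regular_epi C b"
proof -
  obtain p a b where ab: "a \<in> hom C p x" "b \<in> hom C p y" "is_pullback C a b f g"
    using pullback_exists assms by (metis regular_def)
  then show thesis
    using that assms pullbackD(2)[OF ab(3,1) assms(3,4)] unfolding regular_def by blast
qed

text \<open>The coequalizer of the kernel pair of \<open>f\<close> is the image: two generalized elements with the same
  image in the codomain lift to the domain after passing to a cover, where they are identified.\<close>

lemma image_exists:
  assumes "regular C" "f \<in> hom C a b"
  obtains i e m where "e \<in> hom C a i" "regular_epi C e" "m \<in> hom C i b" "monic C m" "m \<cdot> e = f"
proof -
  obtain k r s where rs: "r \<in> hom C k a" "s \<in> hom C k a" "is_pullback C r s f f"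
    using pullback_exists assms by (metis regular_def)
  then obtain e where e0: "is_coequalizer C e r s"
    using assms(1) unfolding regular_def is_kernel_pair_def by blast
  then have epi: "regular_epi C e"
    by (auto simp: regular_epi_def)
  define i where "i = Cod C e"
  have e: "e \<in> hom C a i" "regular_epi C e" "e \<cdot> r = e \<cdot> s"
    using e0 epi homD(3)[OF rs(1)] by (simp_all add: is_coequalizer_def i_def)
  obtain m where m: "m \<in> hom C i b" "m \<cdot> e = f"
    using e0 homD(3)[OF rs(1)] assms(2) pullbackD(2)[OF rs(3,1) assms(2,2)]
    unfolding is_coequalizer_def i_def by metis
  have "monic C m"
    unfolding monic_def
  proof (intro conjI allI ballI impI)
    show "m \<in> Arr C"
      using m by (simp add: hom_def)
    fix t g h
    assume "g \<in> hom C t (Dom C m)" "h \<in> hom C t (Dom C m)" and eq: "m \<cdot> g = m \<cdot> h"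
    then have gh: "g \<in> hom C t i" "h \<in> hom C t i"
      using m by (auto simp: hom_def)
    obtain t1 u1 b1 where 1: "u1 \<in> hom C t1 a" "b1 \<in> hom C t1 t" "e \<cdot> u1 = g \<cdot> b1" "regular_epi C b1"
      using regular_pullback_regular_epi[OF assms(1) e(2,1) gh(1)] .
    note hb1 = Comp_in_hom[OF 1(2) gh(2)] and gb1 = Comp_in_hom[OF 1(2) gh(1)]
    obtain t2 u2 b2 where 2: "u2 \<in> hom C t2 a" "b2 \<in> hom C t2 t1" "e \<cdot> u2 = (h \<cdot> b1) \<cdot> b2" "regular_epi C b2"
      using regular_pullback_regular_epi[OF assms(1) e(2,1) hb1] .
    note u12 = Comp_in_hom[OF 2(2) 1(1)]
    have eu: "e \<cdot> (u1 \<cdot> b2) = (g \<cdot> b1) \<cdot> b2"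
      using Comp_reassoc[OF 1(3) 2(2) 1(1) e(1)] .
    have "f \<cdot> (u1 \<cdot> b2) = m \<cdot> (e \<cdot> (u1 \<cdot> b2))"
      using Comp_reassoc[OF m(2) u12 e(1) m(1)] by simp
    also have "\<dots> = (m \<cdot> g) \<cdot> (b1 \<cdot> b2)"
      unfolding eu using m(1) gh 1(2) 2(2) by (simp add: hom_def assoc)
    also have "\<dots> = m \<cdot> (e \<cdot> u2)"
      unfolding eq 2(3) using m(1) gh 1(2) 2(2) by (simp add: hom_def assoc)
    also have "\<dots> = f \<cdot> u2"
      using Comp_reassoc[OF m(2) 2(1) e(1) m(1)] by simp
    finally obtain w where w: "w \<in> hom C t2 k" "r \<cdot> w = u1 \<cdot> b2" "s \<cdot> w = u2"
      using pullback_lift[OF rs(3,1) assms(2,2) u12 2(1)] by blast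
    have "e \<cdot> (u1 \<cdot> b2) = e \<cdot> u2"
      using Comp_reassoc[OF e(3) w(1) rs(1) e(1)] Comp_assoc[OF w(1) rs(2) e(1)] w by simp
    then have "(g \<cdot> b1) \<cdot> b2 = (h \<cdot> b1) \<cdot> b2"
      using eu 2(3) by simp
    then have "g \<cdot> b1 = h \<cdot> b1"
      using regular_epi_cancel[OF 2(4,2) gb1 hb1] by simp
    then show "g = h"
      using regular_epi_cancel[OF 1(4,2) gh] by simp
  qed
  then show thesis
    using that e m by blast
qed

end


section \<open>Zero arrows and kernels\<close>

locale pointed_category = category +
  assumes pointed: "pointed C"
begin

text \<open>This gives meaning to the definite description in \<open>zero_arr\<close>: the
  comparison arrow between two zero objects identifies the factorizations through them.\<close>

lemma zero_arr_eq:
  assumes "is_zero C z" "g \<in> hom C a z" "h \<in> hom C z b"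
  shows "zero_arr C a b = h \<cdot> g"
  unfolding zero_arr_def
proof (rule the_equality)
  show "\<exists>z g' h'. is_zero C z \<and> g' \<in> hom C a z \<and> h' \<in> hom C z b \<and> h \<cdot> g = h' \<cdot> g'"
    using assms by blast
  fix f
  assume "\<exists>z g h. is_zero C z \<and> g \<in> hom C a z \<and> h \<in> hom C z b \<and> f = h \<cdot> g"
  then obtain z' g' h' where 1: "is_zero C z'" "g' \<in> hom C a z'" "h' \<in> hom C z' b" "f = h' \<cdot> g'"
    by blast
  obtain k where k: "k \<in> hom C z z'"
    using assms(1) 1(1) by (metis is_zero_def is_initial_def is_terminal_def)
  have "k \<cdot> g = g'"
    using Comp_in_hom[OF assms(2) k] 1(1,2) homD[OF assms(2)]
    by (metis is_zero_def is_terminal_def)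
  moreover have "h' \<cdot> k = h"
    using Comp_in_hom[OF k 1(3)] assms(1,3) homD[OF assms(3)]
    by (metis is_zero_def is_initial_def)
  ultimately show "f = h \<cdot> g"
    using Comp_assoc[OF assms(2) k 1(3)] 1(4) by simp
qed

lemma zero_exists:
  obtains z where "is_zero C z" "z \<in> Obj C"
    "\<forall>a \<in> Obj C. \<exists>f. f \<in> hom C a z" "\<forall>a \<in> Obj C. \<exists>f. f \<in> hom C z a"
    "\<forall>a. \<forall>f \<in> hom C a z. \<forall>g \<in> hom C a z. f = g"
proof -
  obtain z where z: "is_zero C z"
    using pointed by (auto simp: pointed_def)
  have "\<forall>a. \<forall>f \<in> hom C a z. \<forall>g \<in> hom C a z. f = g"
    using z homD(4) by (metis is_zero_def is_terminal_def)
  then show thesis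
    using z by (intro that[of z]) (auto simp: is_zero_def is_initial_def is_terminal_def)
qed

lemma zero_factorization:
  assumes "a \<in> Obj C" "b \<in> Obj C"
  obtains z g h where "is_zero C z" "g \<in> hom C a z" "h \<in> hom C z b"
proof -
  obtain z where z: "is_zero C z" "z \<in> Obj C"
    "\<forall>a \<in> Obj C. \<exists>f. f \<in> hom C a z" "\<forall>a \<in> Obj C. \<exists>f. f \<in> hom C z a"
    "\<forall>a. \<forall>f \<in> hom C a z. \<forall>g \<in> hom C a z. f = g"
    using zero_exists .
  then show thesis
    using that assms by blast
qed

lemma zero_arr_in_hom:
  assumes "a \<in> Obj C" "b \<in> Obj C"
  shows "zero_arr C a b \<in> hom C a b"
proof -
  obtain z g h where z: "is_zero C z" "g \<in> hom C a z" "h \<in> hom C z b"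
    using zero_factorization[OF assms] .
  then show ?thesis
    using zero_arr_eq[OF z] Comp_in_hom[OF z(2,3)] by simp
qed

lemma Comp_zero_arr:
  assumes "f \<in> hom C b c" "a \<in> Obj C"
  shows "f \<cdot> zero_arr C a b = zero_arr C a c"
proof -
  obtain z g h where z: "is_zero C z" "g \<in> hom C a z" "h \<in> hom C z b"
    using zero_factorization[OF assms(2) homD(4)[OF assms(1)]] .
  show ?thesis
    using zero_arr_eq[OF z] zero_arr_eq[OF z(1,2) Comp_in_hom[OF z(3) assms(1)]]
      Comp_assoc[OF z(2,3) assms(1)] by simp
qed

lemma zero_arr_Comp:
  assumes "f \<in> hom C a b" "c \<in> Obj C"
  shows "zero_arr C b c \<cdot> f = zero_arr C a c"
proof -
  obtain z g h where z: "is_zero C z" "g \<in> hom C b z" "h \<in> hom C z c"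
    using zero_factorization[OF homD(5)[OF assms(1)] assms(2)] .
  show ?thesis
    using zero_arr_eq[OF z] zero_arr_eq[OF z(1) Comp_in_hom[OF assms(1) z(2)] z(3)]
      Comp_assoc[OF assms(1) z(2,3)] by simp
qed

lemma kernelI:
  assumes "f \<in> hom C a b" "k \<in> hom C c a" "f \<cdot> k = zero_arr C c b"
    and "\<And>t u. u \<in> hom C t a \<Longrightarrow> f \<cdot> u = zero_arr C t b \<Longrightarrow> \<exists>h \<in> hom C t c. k \<cdot> h = u"
    and "monic C k"
  shows "is_kernel C k f"
proof -
  have "\<exists>!h. h \<in> hom C t c \<and> k \<cdot> h = u" if "u \<in> hom C t a" "f \<cdot> u = zero_arr C t b" for t u
    using assms(4)[OF that] monic_cancel[OF assms(5,2)] by metis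
  then show ?thesis
    using assms(1-3) unfolding is_kernel_def by (simp add: hom_def)
qed

lemma kernel_ex1:
  assumes "is_kernel C k f" "f \<in> hom C a b" "u \<in> hom C t a" "f \<cdot> u = zero_arr C t b"
  shows "\<exists>!h. h \<in> hom C t (Dom C k) \<and> k \<cdot> h = u"
  using assms(1,3,4) homD(2,3)[OF assms(2)] unfolding is_kernel_def by blast

lemma kernelD:
  assumes "is_kernel C k f" "f \<in> hom C a b"
  shows "k \<in> hom C (Dom C k) a" "f \<cdot> k = zero_arr C (Dom C k) b" "monic C k"
proof -
  show k: "k \<in> hom C (Dom C k) a" "f \<cdot> k = zero_arr C (Dom C k) b"
    using assms by (auto simp: is_kernel_def hom_def)
  have "g = h" if gh: "g \<in> hom C t (Dom C k)" "h \<in> hom C t (Dom C k)" "k \<cdot> g = k \<cdot> h" for t g h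
  proof -
    have "f \<cdot> (k \<cdot> h) = zero_arr C t b"
      using Comp_reassoc[OF k(2) gh(2) k(1) assms(2)] zero_arr_Comp[OF gh(2)] homD(5)[OF assms(2)]
      by simp
    then have "\<exists>!g. g \<in> hom C t (Dom C k) \<and> k \<cdot> g = k \<cdot> h"
      using kernel_ex1[OF assms Comp_in_hom[OF gh(2) k(1)]] by simp
    then show ?thesis
      using gh by metis
  qed
  then show "monic C k"
    using k(1) by (auto simp: monic_def hom_def)
qed

lemma kernel_lift:
  assumes "is_kernel C k f" "f \<in> hom C a b" "u \<in> hom C t a" "f \<cdot> u = zero_arr C t b"
  obtains h where "h \<in> hom C t (Dom C k)" "k \<cdot> h = u"
  using kernel_ex1[OF assms] by blast

text \<open>The kernel is the pullback of \<open>f\<close> along the arrow from a zero object. It is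
  monic because arrows into a zero object are unique.\<close>

lemma kernel_exists:
  assumes "finitely_complete C" "f \<in> hom C a b"
  obtains k where "is_kernel C k f"
proof -
  obtain z where z: "is_zero C z" "z \<in> Obj C"
    "\<forall>a \<in> Obj C. \<exists>f. f \<in> hom C a z" "\<forall>a \<in> Obj C. \<exists>f. f \<in> hom C z a"
    "\<forall>a. \<forall>f \<in> hom C a z. \<forall>g \<in> hom C a z. f = g"
    using zero_exists .
  obtain i where i: "i \<in> hom C z b"
    using z homD[OF assms(2)] by blast
  obtain c k j where kj: "k \<in> hom C c a" "j \<in> hom C c z" "is_pullback C k j f i"
    using pullback_exists[OF assms i] .
  have "is_kernel C k f"
  proof (rule kernelI[OF assms(2) kj(1)])
    show "f \<cdot> k = zero_arr C c b"
      using pullbackD(2)[OF kj(3,1) assms(2) i] zero_arr_eq[OF z(1) kj(2) i] by simp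
    show "\<exists>h \<in> hom C t c. k \<cdot> h = u" if u: "u \<in> hom C t a" "f \<cdot> u = zero_arr C t b" for t u
    proof -
      obtain v where v: "v \<in> hom C t z"
        using z(3) homD(4)[OF u(1)] by blast
      show ?thesis
        using pullback_lift[OF kj(3,1) assms(2) i u(1) v] u(2) zero_arr_eq[OF z(1) v i] by metis
    qed
    show "monic C k"
      unfolding monic_def
    proof (intro conjI allI ballI impI)
      show "k \<in> Arr C"
        using kj by (simp add: hom_def)
      fix t g h
      assume gh: "g \<in> hom C t (Dom C k)" "h \<in> hom C t (Dom C k)" "k \<cdot> g = k \<cdot> h"
      then have gh': "g \<in> hom C t c" "h \<in> hom C t c"
        using kj by (auto simp: hom_def)
      show "g = h"
        using pullback_unique[OF kj(3,1) assms(2) i gh' gh(3)]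
          z(5) Comp_in_hom[OF gh'(1) kj(2)] Comp_in_hom[OF gh'(2) kj(2)] by blast
    qed
  qed
  then show thesis
    using that by blast
qed

text \<open>Protomodularity speaks of pullbacks of points; this exhibits every kernel as a change of
  base along an arrow from a zero object.\<close>

lemma kernel_is_pullback:
  assumes "is_kernel C k f" "f \<in> hom C a b"
  obtains z i j where "i \<in> hom C z b" "is_pullback C k j f i"
proof -
  obtain z where z: "is_zero C z" "z \<in> Obj C"
    "\<forall>a \<in> Obj C. \<exists>f. f \<in> hom C a z" "\<forall>a \<in> Obj C. \<exists>f. f \<in> hom C z a"
    "\<forall>a. \<forall>f \<in> hom C a z. \<forall>g \<in> hom C a z. f = g"
    using zero_exists .
  note k = kernelD[OF assms]
  obtain i j where ij: "i \<in> hom C z b" "j \<in> hom C (Dom C k) z"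
    using z homD[OF assms(2)] homD[OF k(1)] by metis
  have "is_pullback C k j f i"
  proof (rule pullbackI[OF assms(2) ij(1) k(1) ij(2)])
    show "f \<cdot> k = i \<cdot> j"
      using k(2) zero_arr_eq[OF z(1) ij(2,1)] by simp
    fix t s u
    assume su: "s \<in> hom C t a" "u \<in> hom C t z" "f \<cdot> s = i \<cdot> u"
    then obtain h where h: "h \<in> hom C t (Dom C k)" "k \<cdot> h = s"
      using kernel_lift[OF assms su(1)] zero_arr_eq[OF z(1) su(2) ij(1)] by metis
    then have "j \<cdot> h = u"
      using z(5) su(2) Comp_in_hom[OF h(1) ij(2)] by blast
    then show "\<exists>!h. h \<in> hom C t (Dom C k) \<and> k \<cdot> h = s \<and> j \<cdot> h = u"
      using h monic_cancel[OF k(3,1)] by metis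
  qed
  then show thesis
    using that ij by blast
qed

end


section \<open>Relations in homological categories\<close>

context category
begin

definition jointly_monic :: "'m \<Rightarrow> 'm \<Rightarrow> bool" where
  "jointly_monic r s \<longleftrightarrow> (\<forall>t. \<forall>g \<in> hom C t (Dom C r). \<forall>h \<in> hom C t (Dom C r).
     r \<cdot> g = r \<cdot> h \<and> s \<cdot> g = s \<cdot> h \<longrightarrow> g = h)"

text \<open>Membership of the generalized element \<open>(f, g)\<close> in the relation with legs
  \<open>r\<close> and \<open>s\<close>. With both legs equal to \<open>x\<close>,
  \<open>related x x f f\<close> says that \<open>f\<close> factors through \<open>x\<close>; with
  both legs an identity it is equality of arrows.\<close>

definition related :: "'m \<Rightarrow> 'm \<Rightarrow> 'm \<Rightarrow> 'm \<Rightarrow> bool" where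
  "related r s f g \<longleftrightarrow> (\<exists>h \<in> hom C (Dom C f) (Dom C r). r \<cdot> h = f \<and> s \<cdot> h = g)"

lemma jointly_monicD:
  assumes "jointly_monic r s" "r \<in> hom C a x" "g \<in> hom C t a" "h \<in> hom C t a"
    and "r \<cdot> g = r \<cdot> h" "s \<cdot> g = s \<cdot> h"
  shows "g = h"
  using assms(1,3-6) homD(2)[OF assms(2)] unfolding jointly_monic_def by blast

lemma relatedI:
  assumes "r \<in> hom C a x" "f \<in> hom C t y" "h \<in> hom C t a" "r \<cdot> h = f" "s \<cdot> h = g"
  shows "related r s f g"
  using assms by (auto simp: related_def hom_def)

lemma relatedE:
  assumes "related r s f g" "r \<in> hom C a x" "f \<in> hom C t y"
  obtains h where "h \<in> hom C t a" "r \<cdot> h = f" "s \<cdot> h = g"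
  using assms by (auto simp: related_def hom_def)

lemma related_Comp:
  assumes "related r s f g" "r \<in> hom C a x" "s \<in> hom C a y" "f \<in> hom C b x" "g \<in> hom C b y" "h \<in> hom C t b"
  shows "related r s (f \<cdot> h) (g \<cdot> h)"
proof -
  obtain k where k: "k \<in> hom C b a" "r \<cdot> k = f" "s \<cdot> k = g"
    using relatedE[OF assms(1,2,4)] .
  show ?thesis
    using relatedI[OF assms(2) Comp_in_hom[OF assms(6,4)] Comp_in_hom[OF assms(6) k(1)]]
      Comp_reassoc[OF k(2) assms(6) k(1) assms(2)] Comp_reassoc[OF k(3) assms(6) k(1) assms(3)] by metis
qed

lemma monic_imp_jointly_monic:
  assumes "monic C x" "x \<in> hom C a b"
  shows "jointly_monic x x"
  using monic_cancel[OF assms] homD(2)[OF assms(2)] by (auto simp: jointly_monic_def)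

text \<open>The inverse image of the relation under \<open>\<langle>f, g\<rangle>\<close>, built as
  the pullback of \<open>\<langle>r, s\<rangle>\<close> along \<open>\<langle>f, g\<rangle>\<close>.
  It is the largest subobject of \<open>b\<close> on which \<open>f\<close> and \<open>g\<close> are
  related, which lets a relation be treated as a subobject of \<open>b\<close>.\<close>

lemma relation_pullback:
  assumes "finitely_complete C" "jointly_monic r s" "r \<in> hom C a x" "s \<in> hom C a y"
    and "f \<in> hom C b x" "g \<in> hom C b y"
  obtains c m where "m \<in> hom C c b" "monic C m" "related r s (f \<cdot> m) (g \<cdot> m)"
    "\<forall>t. \<forall>u \<in> hom C t b. related r s (f \<cdot> u) (g \<cdot> u) \<longrightarrow> (\<exists>h \<in> hom C t c. m \<cdot> h = u)"
proof -
  obtain z p q where z: "is_product C x y z p q"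
    using product_exists assms homD(5) by metis
  then have pq: "p \<in> hom C z x" "q \<in> hom C z y"
    by (auto simp: is_product_def)
  have ex1: "\<exists>!h. h \<in> hom C t z \<and> p \<cdot> h = f \<and> q \<cdot> h = g" if "f \<in> hom C t x" "g \<in> hom C t y" for t f g
    using z that by (auto simp: is_product_def)
  obtain w where w: "w \<in> hom C a z" "p \<cdot> w = r" "q \<cdot> w = s"
    using ex1[OF assms(3,4)] by blast
  obtain v where v: "v \<in> hom C b z" "p \<cdot> v = f" "q \<cdot> v = g"
    using ex1[OF assms(5,6)] by blast
  obtain c n m where nm: "n \<in> hom C c a" "m \<in> hom C c b" "is_pullback C n m w v"
    using pullback_exists[OF assms(1) w(1) v(1)] .
  have eq: "w \<cdot> n = v \<cdot> m"
    using pullbackD(2)[OF nm(3,1) w(1) v(1)] .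
  \<comment> \<open>Arrows into the product \<open>z\<close> agree when both components do, so a
    witness of relatedness is the same as a commuting square over \<open>w\<close> and
    \<open>v\<close>.\<close>
  have rw: "r \<cdot> k = f \<cdot> u \<and> s \<cdot> k = g \<cdot> u \<longleftrightarrow> w \<cdot> k = v \<cdot> u"
    if k: "k \<in> hom C t a" and u: "u \<in> hom C t b" for t k u
  proof -
    have "r \<cdot> k = p \<cdot> (w \<cdot> k)" "s \<cdot> k = q \<cdot> (w \<cdot> k)" "f \<cdot> u = p \<cdot> (v \<cdot> u)" "g \<cdot> u = q \<cdot> (v \<cdot> u)"
      using Comp_reassoc[OF w(2) k w(1) pq(1)] Comp_reassoc[OF w(3) k w(1) pq(2)]
        Comp_reassoc[OF v(2) u v(1) pq(1)] Comp_reassoc[OF v(3) u v(1) pq(2)] by simp_all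
    moreover have "\<exists>!h. h \<in> hom C t z \<and> p \<cdot> h = f \<cdot> u \<and> q \<cdot> h = g \<cdot> u"
      using ex1 Comp_in_hom[OF u assms(5)] Comp_in_hom[OF u assms(6)] by blast
    ultimately show ?thesis
      using Comp_in_hom[OF k w(1)] Comp_in_hom[OF u v(1)] by metis
  qed
  have "monic C m"
    unfolding monic_def
  proof (intro conjI allI ballI impI)
    show "m \<in> Arr C"
      using nm by (simp add: hom_def)
    fix t g' h'
    assume "g' \<in> hom C t (Dom C m)" "h' \<in> hom C t (Dom C m)" and e: "m \<cdot> g' = m \<cdot> h'"
    then have gh: "g' \<in> hom C t c" "h' \<in> hom C t c"
      using nm by (auto simp: hom_def)
    have k: "n \<cdot> g' \<in> hom C t a" "n \<cdot> h' \<in> hom C t a" "m \<cdot> h' \<in> hom C t b"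
      using Comp_in_hom gh nm by blast+
    have "w \<cdot> (n \<cdot> g') = v \<cdot> (m \<cdot> g')" "w \<cdot> (n \<cdot> h') = v \<cdot> (m \<cdot> h')"
      using Comp_reassoc[OF eq gh(1) nm(1) w(1)] Comp_reassoc[OF eq gh(2) nm(1) w(1)]
        Comp_assoc[OF gh(1) nm(2) v(1)] Comp_assoc[OF gh(2) nm(2) v(1)] by simp_all
    then have "r \<cdot> (n \<cdot> g') = r \<cdot> (n \<cdot> h')" "s \<cdot> (n \<cdot> g') = s \<cdot> (n \<cdot> h')"
      using rw[OF k(1,3)] rw[OF k(2,3)] e by simp_all
    then have "n \<cdot> g' = n \<cdot> h'"
      using jointly_monicD[OF assms(2,3) k(1,2)] by simp
    then show "g' = h'"
      using pullback_unique[OF nm(3,1) w(1) v(1) gh _ e] by simp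
  qed
  moreover have "related r s (f \<cdot> m) (g \<cdot> m)"
    using rw[OF nm(1,2)] eq relatedI[OF assms(3) Comp_in_hom[OF nm(2) assms(5)] nm(1)] by metis
  moreover have "\<exists>h \<in> hom C t c. m \<cdot> h = u"
    if u: "u \<in> hom C t b" "related r s (f \<cdot> u) (g \<cdot> u)" for t u
  proof -
    obtain k where k: "k \<in> hom C t a" "r \<cdot> k = f \<cdot> u" "s \<cdot> k = g \<cdot> u"
      using relatedE[OF u(2) assms(3) Comp_in_hom[OF u(1) assms(5)]] .
    then show ?thesis
      using pullback_lift[OF nm(3,1) w(1) v(1) k(1) u(1)] rw[OF k(1) u(1)] by metis
  qed
  ultimately show thesis
    using that nm(2) by blast
qed

end

locale homological_category = category +
  assumes homological: "homological C"
begin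

sublocale pointed_category
  using homological by unfold_locales (simp add: homological_def)

lemma complete: "finitely_complete C" and regular: "regular C" and protomodular: "protomodular C"
  using homological by (simp_all add: homological_def)

text \<open>Protomodularity says that the section of a point and the projection from any pullback of it
  are jointly extremally epic.\<close>

lemma point_extremal:
  assumes "p \<in> hom C e b" "s \<in> hom C b e" "p \<cdot> s = Ident C b"
    and "v \<in> hom C b' b" "a \<in> hom C c e" "is_pullback C a p' p v"
    and "monic C m" "m \<in> hom C d e" "a' \<in> hom C c d" "m \<cdot> a' = a" "s' \<in> hom C b d" "m \<cdot> s' = s"
  shows "iso C m"
proof -
  note p' = pullbackD[OF assms(6,5,1,4)]
  note pm = Comp_in_hom[OF assms(8,1)]
  have 1: "is_point C b p s"
    using assms(1-3) homD[OF assms(1)] by (simp add: is_point_def)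
  have 2: "is_point C b (p \<cdot> m) s'"
    using Comp_assoc[OF assms(11,8,1)] assms(3,11,12) homD[OF pm] pm by (simp add: is_point_def)
  have 3: "is_point_map C (p \<cdot> m) s' p s m"
    using assms(1,8,12) homD[OF pm] homD[OF assms(1)] by (simp add: is_point_map_def)
  \<comment> \<open>Since \<open>a\<close> already factors through \<open>m\<close>, restricting the
    point along \<open>m\<close> leaves its pullback along \<open>v\<close> unchanged. The induced
    comparison is then an identity, and protomodularity reflects its invertibility to
    \<open>m\<close>.\<close>
  have 4: "is_pullback C a' p' (p \<cdot> m) v"
  proof (rule pullbackI[OF pm assms(4,9) p'(1)])
    show "(p \<cdot> m) \<cdot> a' = v \<cdot> p'"
      using Comp_assoc[OF assms(9,8,1)] assms(10) p'(2) by simp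
    fix t f g
    assume f: "f \<in> hom C t d" and g: "g \<in> hom C t b'" and fg: "(p \<cdot> m) \<cdot> f = v \<cdot> g"
    note mf = Comp_in_hom[OF f assms(8)]
    have "\<exists>!h. h \<in> hom C t c \<and> a \<cdot> h = m \<cdot> f \<and> p' \<cdot> h = g"
      using pullback_ex1[OF assms(6,5,1,4) mf g] fg Comp_assoc[OF f assms(8,1)] by simp
    moreover have "a \<cdot> h = m \<cdot> f \<longleftrightarrow> a' \<cdot> h = f" if "h \<in> hom C t c" for h
      using Comp_reassoc[OF assms(10) that assms(9,8)]
        monic_cancel[OF assms(7,8) Comp_in_hom[OF that assms(9)] f] by auto
    ultimately show "\<exists>!h. h \<in> hom C t c \<and> a' \<cdot> h = f \<and> p' \<cdot> h = g"
      by metis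
  qed
  have c: "c \<in> Obj C"
    using homD[OF assms(5)] by simp
  have "a \<cdot> Ident C c = m \<cdot> a'" "p' \<cdot> Ident C c = p'" "iso C (Ident C c)"
    "Ident C c \<in> hom C (Dom C a') (Dom C a)"
    using Comp_Ident_right[OF assms(5)] Comp_Ident_right[OF p'(1)] assms(10) iso_Ident[OF c]
      Ident_in_hom[OF c] homD[OF assms(5)] homD[OF assms(9)] by simp_all
  then show ?thesis
    using protomodular 1 2 3 4 assms(6) unfolding protomodular_def by blast
qed

text \<open>The largest subobject \<open>m\<close> on which \<open>f\<close> and \<open>g\<close>
  are related contains both the section \<open>\<sigma>\<close> and the pullback projection
  \<open>a\<close>; by extremality \<open>m\<close> is invertible, so the relation holds
  everywhere.\<close>

lemma point_related:
  assumes "p \<in> hom C e b" "\<sigma> \<in> hom C b e" "p \<cdot> \<sigma> = Ident C b"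
    and "v \<in> hom C b' b" "a \<in> hom C c e" "is_pullback C a p' p v"
    and "jointly_monic r s" "r \<in> hom C d x" "s \<in> hom C d y" "f \<in> hom C e x" "g \<in> hom C e y"
    and "related r s (f \<cdot> \<sigma>) (g \<cdot> \<sigma>)" "related r s (f \<cdot> a) (g \<cdot> a)"
  shows "related r s f g"
proof -
  obtain k m where m: "m \<in> hom C k e" "monic C m" "related r s (f \<cdot> m) (g \<cdot> m)"
    "\<forall>t. \<forall>u \<in> hom C t e. related r s (f \<cdot> u) (g \<cdot> u) \<longrightarrow> (\<exists>h \<in> hom C t k. m \<cdot> h = u)"
    using relation_pullback[OF complete assms(7-11)] .
  obtain \<sigma>' a' where lifts: "\<sigma>' \<in> hom C b k" "m \<cdot> \<sigma>' = \<sigma>" "a' \<in> hom C c k" "m \<cdot> a' = a"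
    using m(4) assms(2,5,12,13) by blast
  have "iso C m"
    using point_extremal[OF assms(1-6) m(2,1) lifts(3,4,1,2)] .
  then obtain n where n: "n \<in> hom C e k" "n \<cdot> m = Ident C k" "m \<cdot> n = Ident C e"
    using iso_inverse m(1) by blast
  have "related r s ((f \<cdot> m) \<cdot> n) ((g \<cdot> m) \<cdot> n)"
    using related_Comp[OF m(3) assms(8,9) Comp_in_hom[OF m(1) assms(10)] Comp_in_hom[OF m(1) assms(11)] n(1)] .
  then show ?thesis
    using Comp_assoc[OF n(1) m(1) assms(10)] Comp_assoc[OF n(1) m(1) assms(11)] n(3)
      Comp_Ident_right[OF assms(10)] Comp_Ident_right[OF assms(11)] by simp
qed

text \<open>The case of base change along an arrow from a zero object: section and kernel together
  test any relation. It yields both that a reflexive relation is controlled by its zero class and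
  that \<open>X\<close> and \<open>(X|A)\<close> generate a kernel.\<close>

lemma point_kernel_related:
  assumes "p \<in> hom C e b" "\<sigma> \<in> hom C b e" "p \<cdot> \<sigma> = Ident C b" "is_kernel C k p"
    and "jointly_monic r s" "r \<in> hom C d x" "s \<in> hom C d y" "f \<in> hom C e x" "g \<in> hom C e y"
    and "related r s (f \<cdot> \<sigma>) (g \<cdot> \<sigma>)" "related r s (f \<cdot> k) (g \<cdot> k)"
  shows "related r s f g"
proof -
  obtain z i j where "i \<in> hom C z b" "is_pullback C k j p i"
    using kernel_is_pullback[OF assms(4,1)] .
  then show ?thesis
    using point_related[OF assms(1-3) _ kernelD(1)[OF assms(4,1)] _ assms(5-11)] by blast
qed

text \<open>Relations in a protomodular category are difunctional: consider the object of triples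
  \<open>(a, b, c)\<close> with \<open>s a = s b\<close> and \<open>r b = r c\<close> as a point over the object of pairs \<open>(b, c)\<close>. The
  section \<open>(b, b, c)\<close> and the pullback \<open>(a, b, b)\<close> satisfy \<open>(r a, s c) \<in> R\<close>, hence so do all
  triples.\<close>

lemma difunctional:
  assumes "jointly_monic r s" "r \<in> hom C R x" "s \<in> hom C R y"
    and "a \<in> hom C t R" "b \<in> hom C t R" "c \<in> hom C t R" "s \<cdot> a = s \<cdot> b" "r \<cdot> b = r \<cdot> c"
  shows "related r s (r \<cdot> a) (s \<cdot> c)"
proof -
  have R: "Ident C R \<in> hom C R R" "R \<in> Obj C"
    using homD[OF assms(2)] Ident_in_hom by simp_all
  obtain E e1 e2 where e: "e1 \<in> hom C E R" "e2 \<in> hom C E R" "is_pullback C e1 e2 s s"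
    using pullback_exists[OF complete assms(3,3)] .
  obtain F f1 f2 where f: "f1 \<in> hom C F R" "f2 \<in> hom C F R" "is_pullback C f1 f2 r r"
    using pullback_exists[OF complete assms(2,2)] .
  obtain P p q where p: "p \<in> hom C P E" "q \<in> hom C P F" "is_pullback C p q e2 f1"
    using pullback_exists[OF complete e(2) f(1)] .
  note e_eq = pullbackD(2)[OF e(3,1) assms(3,3)]
  note f_eq = pullbackD(2)[OF f(3,1) assms(2,2)]
  note p_eq = pullbackD(2)[OF p(3,1) e(2) f(1)]
  \<comment> \<open>\<open>E\<close> carries the pairs \<open>(a, b)\<close>, \<open>F\<close> the
    pairs \<open>(b, c)\<close> and \<open>P\<close> the triples; \<open>\<delta>\<close> and
    \<open>w\<close> are the diagonals of \<open>E\<close> and \<open>F\<close>. The section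
    \<open>\<sigma>\<close> comes from \<open>\<delta>\<close>, and the base change is along
    \<open>w\<close>.\<close>
  obtain \<delta> where \<delta>: "\<delta> \<in> hom C R E" "e1 \<cdot> \<delta> = Ident C R" "e2 \<cdot> \<delta> = Ident C R"
    using pullback_lift[OF e(3,1) assms(3,3) R(1) R(1)] by blast
  obtain w where w: "w \<in> hom C R F" "f1 \<cdot> w = Ident C R" "f2 \<cdot> w = Ident C R"
    using pullback_lift[OF f(3,1) assms(2,2) R(1) R(1)] by blast
  have F: "Ident C F \<in> hom C F F" and E: "Ident C E \<in> hom C E E"
    using homD[OF f(1)] homD[OF e(1)] Ident_in_hom by simp_all
  have "e2 \<cdot> (\<delta> \<cdot> f1) = f1 \<cdot> Ident C F"
    using Comp_reassoc[OF \<delta>(3) f(1) \<delta>(1) e(2)] Comp_Ident_left[OF f(1)] Comp_Ident_right[OF f(1)] by simp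
  then obtain \<sigma> where \<sigma>: "\<sigma> \<in> hom C F P" "p \<cdot> \<sigma> = \<delta> \<cdot> f1" "q \<cdot> \<sigma> = Ident C F"
    using pullback_lift[OF p(3,1) e(2) f(1) Comp_in_hom[OF f(1) \<delta>(1)] F] by metis
  note we2 = Comp_in_hom[OF e(2) w(1)]
  have "e2 \<cdot> Ident C E = f1 \<cdot> (w \<cdot> e2)"
    using Comp_reassoc[OF w(2) e(2) w(1) f(1)] Comp_Ident_left[OF e(2)] Comp_Ident_right[OF e(2)] by simp
  then obtain \<tau> where \<tau>: "\<tau> \<in> hom C E P" "p \<cdot> \<tau> = Ident C E" "q \<cdot> \<tau> = w \<cdot> e2"
    using pullback_lift[OF p(3,1) e(2) f(1) E we2] by metis
  have pb: "is_pullback C \<tau> e2 q w"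
  proof (rule pullbackI[OF p(2) w(1) \<tau>(1) e(2) \<tau>(3)])
    fix t' g h
    assume g: "g \<in> hom C t' P" and h: "h \<in> hom C t' R" and gh: "q \<cdot> g = w \<cdot> h"
    note pg = Comp_in_hom[OF g p(1)]
    have "e2 \<cdot> (p \<cdot> g) = f1 \<cdot> (q \<cdot> g)"
      using Comp_reassoc[OF p_eq g p(1) e(2)] Comp_assoc[OF g p(2) f(1)] by simp
    also have "\<dots> = h"
      using gh Comp_reassoc[OF w(2) h w(1) f(1)] Comp_Ident_left[OF h] by simp
    finally have h_eq: "e2 \<cdot> (p \<cdot> g) = h" .
    have "p \<cdot> (\<tau> \<cdot> (p \<cdot> g)) = p \<cdot> g"
      using Comp_reassoc[OF \<tau>(2) pg \<tau>(1) p(1)] Comp_Ident_left[OF pg] by simp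
    moreover have "q \<cdot> (\<tau> \<cdot> (p \<cdot> g)) = q \<cdot> g"
      using Comp_reassoc[OF \<tau>(3) pg \<tau>(1) p(2)] Comp_assoc[OF pg e(2) w(1)] h_eq gh by simp
    ultimately have "\<tau> \<cdot> (p \<cdot> g) = g"
      using pullback_unique[OF p(3,1) e(2) f(1) Comp_in_hom[OF pg \<tau>(1)] g] by simp
    moreover have "k = p \<cdot> g" if "k \<in> hom C t' E" "\<tau> \<cdot> k = g" for k
      using Comp_reassoc[OF \<tau>(2) that(1) \<tau>(1) p(1)] Comp_Ident_left[OF that(1)] that(2) by simp
    ultimately show "\<exists>!k. k \<in> hom C t' E \<and> \<tau> \<cdot> k = g \<and> e2 \<cdot> k = h"
      using pg h_eq by metis
  qed
  define g1 where "g1 = r \<cdot> (e1 \<cdot> p)"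
  define g2 where "g2 = s \<cdot> (f2 \<cdot> q)"
  have g: "g1 \<in> hom C P x" "g2 \<in> hom C P y"
    using Comp_in_hom[OF Comp_in_hom[OF p(1) e(1)] assms(2)]
      Comp_in_hom[OF Comp_in_hom[OF p(2) f(2)] assms(3)] by (simp_all add: g1_def g2_def)
  have gu: "g1 \<cdot> u = r \<cdot> (e1 \<cdot> (p \<cdot> u))" "g2 \<cdot> u = s \<cdot> (f2 \<cdot> (q \<cdot> u))" if "u \<in> hom C t' P" for u t'
    using that assms(2,3) e(1) p(1,2) f(2) by (simp_all add: g1_def g2_def hom_def assoc)
  \<comment> \<open>On \<open>(b, b, c)\<close> the pair is \<open>(r b, s c) = (r c, s c)\<close>,
    witnessed by \<open>c\<close>. On \<open>(a, b, b)\<close>, treated next, it is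
    \<open>(r a, s b) = (r a, s a)\<close>, witnessed by \<open>a\<close>.\<close>
  have "g1 \<cdot> \<sigma> = r \<cdot> f2" "g2 \<cdot> \<sigma> = s \<cdot> f2"
    using gu[OF \<sigma>(1)] \<sigma> Comp_reassoc[OF \<delta>(2) f(1) \<delta>(1) e(1)] Comp_Ident_left[OF f(1)]
      Comp_Ident_right[OF f(2)] f_eq by simp_all
  then have 1: "related r s (g1 \<cdot> \<sigma>) (g2 \<cdot> \<sigma>)"
    using relatedI[OF assms(2) Comp_in_hom[OF f(2) assms(2)] f(2)] by simp
  have "g1 \<cdot> \<tau> = r \<cdot> e1" "g2 \<cdot> \<tau> = s \<cdot> e1"
    using gu[OF \<tau>(1)] \<tau> Comp_reassoc[OF w(3) e(2) w(1) f(2)] Comp_Ident_left[OF e(2)]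
      Comp_Ident_right[OF e(1)] e_eq by simp_all
  then have 2: "related r s (g1 \<cdot> \<tau>) (g2 \<cdot> \<tau>)"
    using relatedI[OF assms(2) Comp_in_hom[OF e(1) assms(2)] e(1)] by simp
  have "related r s g1 g2"
    using point_related[OF p(2) \<sigma>(1,3) w(1) \<tau>(1) pb assms(1-3) g 1 2] .
  moreover obtain k where k: "k \<in> hom C t E" "e1 \<cdot> k = a" "e2 \<cdot> k = b"
    using pullback_lift[OF e(3,1) assms(3,3) assms(4,5,7)] .
  moreover obtain l where l: "l \<in> hom C t F" "f1 \<cdot> l = b" "f2 \<cdot> l = c"
    using pullback_lift[OF f(3,1) assms(2,2) assms(5,6,8)] .
  moreover obtain h where h: "h \<in> hom C t P" "p \<cdot> h = k" "q \<cdot> h = l"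
    using pullback_lift[OF p(3,1) e(2) f(1) k(1) l(1)] k l by metis
  ultimately show ?thesis
    using related_Comp[OF _ assms(2,3) g h(1)] gu[OF h(1)] by simp
qed

text \<open>Difunctionality with diagonal pairs inserted. Symmetry comes from the chain
  \<open>(v, v)\<close>, \<open>(u, v)\<close>, \<open>(u, u)\<close>, which yields
  \<open>(v, u)\<close>; transitivity from \<open>(u, v)\<close>, \<open>(v, v)\<close>,
  \<open>(v, w)\<close>, which yields \<open>(u, w)\<close>.\<close>

lemma reflexive_relation_is_equivalence:
  assumes "jointly_monic r s" "r \<in> hom C R x" "s \<in> hom C R x"
    and "d \<in> hom C x R" "r \<cdot> d = Ident C x" "s \<cdot> d = Ident C x"
  shows "is_equivalence_relation C x R r s"
  unfolding is_equivalence_relation_def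
proof (intro conjI allI ballI impI)
  have R: "Ident C R \<in> hom C R R" "R \<in> Obj C"
    using homD[OF assms(2)] Ident_in_hom by simp_all
  have dr: "r \<cdot> (d \<cdot> u) = u" "s \<cdot> (d \<cdot> u) = u" if "u \<in> hom C t x" for t u
    using Comp_reassoc[OF assms(5) that assms(4,2)] Comp_reassoc[OF assms(6) that assms(4,3)]
      Comp_Ident_left[OF that] by simp_all
  show "x \<in> Obj C" "r \<in> hom C R x" "s \<in> hom C R x"
    using assms homD by auto
  show "g = h" if "g \<in> hom C t R" "h \<in> hom C t R" "r \<cdot> g = r \<cdot> h \<and> s \<cdot> g = s \<cdot> h" for t g h
    using jointly_monicD[OF assms(1,2) that(1,2)] that(3) by simp
  show "\<exists>d \<in> hom C x R. r \<cdot> d = Ident C x \<and> s \<cdot> d = Ident C x"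
    using assms(4-6) by blast
  have "related r s (r \<cdot> (d \<cdot> s)) (s \<cdot> (d \<cdot> r))"
    using difunctional[OF assms(1-3) Comp_in_hom[OF assms(3,4)] R(1) Comp_in_hom[OF assms(2,4)]]
      dr[OF assms(3)] dr[OF assms(2)] Comp_Ident_right[OF assms(3)] Comp_Ident_right[OF assms(2)] by simp
  then have "related r s s r"
    using dr[OF assms(3)] dr[OF assms(2)] by simp
  then show "\<exists>w \<in> hom C R R. r \<cdot> w = s \<and> s \<cdot> w = r"
    using relatedE[OF _ assms(2,3)] by metis
  fix a b
  assume pb: "is_pullback C a b s r"
  then have a: "a \<in> hom C (Dom C a) R"
    using homD[OF assms(3)] by (simp add: is_pullback_def)
  note b = pullbackD[OF pb a assms(3,2)]
  note sa = Comp_in_hom[OF a assms(3)]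
  have "related r s (r \<cdot> a) (s \<cdot> b)"
    using difunctional[OF assms(1-3) a Comp_in_hom[OF sa assms(4)] b(1)] dr[OF sa] b(2) by simp
  then show "\<exists>c \<in> hom C (Dom C a) R. r \<cdot> c = r \<cdot> a \<and> s \<cdot> c = s \<cdot> b"
    using relatedE[OF _ assms(2) Comp_in_hom[OF a assms(2)]] by metis
qed

end

section \<open>Stability under conjugation\<close>

locale cocomplete_homological_category = homological_category +
  assumes cocomplete: "finitely_cocomplete C"
begin

section \<open>Chosen products and coproducts\<close>

lemma is_product_prod_obj:
  assumes "x \<in> Obj C" "y \<in> Obj C"
  shows "is_product C x y (prod_obj C x y) (proj1 C x y) (proj2 C x y)"
proof -
  have "\<exists>P. case P of (P, p, q) \<Rightarrow> is_product C x y P p q"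
    using product_exists[OF complete assms] by auto
  from someI_ex[OF this] have "case product C x y of (S, i, j) \<Rightarrow> is_product C x y S i j"
    unfolding product_def .
  then show ?thesis
    unfolding prod_obj_def proj1_def proj2_def by (simp add: case_prod_beta)
qed

lemma is_coproduct_coprod_obj:
  assumes "x \<in> Obj C" "y \<in> Obj C"
  shows "is_coproduct C x y (coprod_obj C x y) (inj1 C x y) (inj2 C x y)"
proof -
  have "\<exists>S. case S of (S, i, j) \<Rightarrow> is_coproduct C x y S i j"
    using coproduct_exists[OF cocomplete assms] by auto
  from someI_ex[OF this] have "case coproduct C x y of (S, i, j) \<Rightarrow> is_coproduct C x y S i j"
    unfolding coproduct_def .
  then show ?thesis
    unfolding coprod_obj_def inj1_def inj2_def by (simp add: case_prod_beta)
qed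

lemma proj_in_hom:
  assumes "x \<in> Obj C" "y \<in> Obj C"
  shows "proj1 C x y \<in> hom C (prod_obj C x y) x" "proj2 C x y \<in> hom C (prod_obj C x y) y"
  using is_product_prod_obj[OF assms] by (auto simp: is_product_def)

lemma inj_in_hom:
  assumes "x \<in> Obj C" "y \<in> Obj C"
  shows "inj1 C x y \<in> hom C x (coprod_obj C x y)" "inj2 C x y \<in> hom C y (coprod_obj C x y)"
  using is_coproduct_coprod_obj[OF assms] by (auto simp: is_coproduct_def)

lemma pair_props:
  assumes "f \<in> hom C t x" "g \<in> hom C t y"
  shows "pair C f g \<in> hom C t (prod_obj C x y)"
    "proj1 C x y \<cdot> pair C f g = f" "proj2 C x y \<cdot> pair C f g = g"
proof -
  have "\<exists>!h. h \<in> hom C t (prod_obj C x y) \<and> proj1 C x y \<cdot> h = f \<and> proj2 C x y \<cdot> h = g"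
    using is_product_prod_obj[OF homD(5)[OF assms(1)] homD(5)[OF assms(2)]] assms
    unfolding is_product_def by blast
  from theI'[OF this]
  show "pair C f g \<in> hom C t (prod_obj C x y)"
    "proj1 C x y \<cdot> pair C f g = f" "proj2 C x y \<cdot> pair C f g = g"
    using homD[OF assms(1)] homD[OF assms(2)] by (simp_all add: pair_def)
qed

lemma prod_obj_eqI:
  assumes "x \<in> Obj C" "y \<in> Obj C" "h \<in> hom C t (prod_obj C x y)" "k \<in> hom C t (prod_obj C x y)"
    and "proj1 C x y \<cdot> h = proj1 C x y \<cdot> k" "proj2 C x y \<cdot> h = proj2 C x y \<cdot> k"
  shows "h = k"
  using is_product_prod_obj[OF assms(1,2)] Comp_in_hom[OF assms(4) proj_in_hom(1)[OF assms(1,2)]]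
    Comp_in_hom[OF assms(4) proj_in_hom(2)[OF assms(1,2)]] assms(3-6)
  unfolding is_product_def by metis

lemma copair_props:
  assumes "f \<in> hom C x t" "g \<in> hom C y t"
  shows "copair C f g \<in> hom C (coprod_obj C x y) t"
    "copair C f g \<cdot> inj1 C x y = f" "copair C f g \<cdot> inj2 C x y = g"
proof -
  have "\<exists>!h. h \<in> hom C (coprod_obj C x y) t \<and> h \<cdot> inj1 C x y = f \<and> h \<cdot> inj2 C x y = g"
    using is_coproduct_coprod_obj[OF homD(4)[OF assms(1)] homD(4)[OF assms(2)]] assms
    unfolding is_coproduct_def by blast
  from theI'[OF this]
  show "copair C f g \<in> hom C (coprod_obj C x y) t"
    "copair C f g \<cdot> inj1 C x y = f" "copair C f g \<cdot> inj2 C x y = g"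
    using homD[OF assms(1)] homD[OF assms(2)] by (simp_all add: copair_def)
qed

lemma coprod_obj_eqI:
  assumes "x \<in> Obj C" "y \<in> Obj C" "h \<in> hom C (coprod_obj C x y) t" "k \<in> hom C (coprod_obj C x y) t"
    and "h \<cdot> inj1 C x y = k \<cdot> inj1 C x y" "h \<cdot> inj2 C x y = k \<cdot> inj2 C x y"
  shows "h = k"
  using is_coproduct_coprod_obj[OF assms(1,2)] Comp_in_hom[OF inj_in_hom(1)[OF assms(1,2)] assms(4)]
    Comp_in_hom[OF inj_in_hom(2)[OF assms(1,2)] assms(4)] assms(3-6)
  unfolding is_coproduct_def by metis

lemma Comp_copair:
  assumes "f \<in> hom C x t" "g \<in> hom C y t" "h \<in> hom C t u"
  shows "h \<cdot> copair C f g = copair C (h \<cdot> f) (h \<cdot> g)"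
proof -
  note xy = homD(4)[OF assms(1)] homD(4)[OF assms(2)]
  note fg = copair_props[OF assms(1,2)]
  note hfg = copair_props[OF Comp_in_hom[OF assms(1,3)] Comp_in_hom[OF assms(2,3)]]
  show ?thesis
    using coprod_obj_eqI[OF xy Comp_in_hom[OF fg(1) assms(3)] hfg(1)] hfg(2,3) fg(2,3)
      Comp_assoc[OF inj_in_hom(1)[OF xy] fg(1) assms(3)]
      Comp_assoc[OF inj_in_hom(2)[OF xy] fg(1) assms(3)] by simp
qed

lemma copair_coprod_map:
  assumes "f \<in> hom C x x'" "g \<in> hom C y y'" "h \<in> hom C x' t" "k \<in> hom C y' t"
  shows "coprod_map C f g \<in> hom C (coprod_obj C x y) (coprod_obj C x' y')"
    "copair C h k \<cdot> coprod_map C f g = copair C (h \<cdot> f) (k \<cdot> g)"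
proof -
  note xy = homD(5)[OF assms(1)] homD(5)[OF assms(2)]
  note ij = inj_in_hom[OF xy]
  note fg = Comp_in_hom[OF assms(1) ij(1)] Comp_in_hom[OF assms(2) ij(2)]
  have def: "coprod_map C f g = copair C (inj1 C x' y' \<cdot> f) (inj2 C x' y' \<cdot> g)"
    using homD[OF assms(1)] homD[OF assms(2)] by (simp add: coprod_map_def)
  show "coprod_map C f g \<in> hom C (coprod_obj C x y) (coprod_obj C x' y')"
    using copair_props(1)[OF fg] def by simp
  note hk = copair_props[OF assms(3,4)]
  show "copair C h k \<cdot> coprod_map C f g = copair C (h \<cdot> f) (k \<cdot> g)"
    using Comp_copair[OF fg hk(1)] def Comp_reassoc[OF hk(2) assms(1) ij(1) hk(1)]
      Comp_reassoc[OF hk(3) assms(2) ij(2) hk(1)] by simp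
qed

section \<open>Co-smash products and the conjugation action\<close>

lemma coprod_to_prod_props:
  assumes "x \<in> Obj C" "y \<in> Obj C"
  shows "coprod_to_prod C x y \<in> hom C (coprod_obj C x y) (prod_obj C x y)"
    "proj1 C x y \<cdot> coprod_to_prod C x y = copair C (Ident C x) (zero_arr C y x)"
    "proj2 C x y \<cdot> coprod_to_prod C x y = copair C (zero_arr C x y) (Ident C y)"
proof -
  note x = pair_props[OF Ident_in_hom[OF assms(1)] zero_arr_in_hom[OF assms]]
  note y = pair_props[OF zero_arr_in_hom[OF assms(2,1)] Ident_in_hom[OF assms(2)]]
  note pq = proj_in_hom[OF assms]
  show "coprod_to_prod C x y \<in> hom C (coprod_obj C x y) (prod_obj C x y)"
    using copair_props(1)[OF x(1) y(1)] by (simp add: coprod_to_prod_def)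
  show "proj1 C x y \<cdot> coprod_to_prod C x y = copair C (Ident C x) (zero_arr C y x)"
    using Comp_copair[OF x(1) y(1) pq(1)] x(2) y(2) by (simp add: coprod_to_prod_def)
  show "proj2 C x y \<cdot> coprod_to_prod C x y = copair C (zero_arr C x y) (Ident C y)"
    using Comp_copair[OF x(1) y(1) pq(2)] x(3) y(3) by (simp add: coprod_to_prod_def)
qed

text \<open>An arrow into a product is zero exactly when both components are. Thus
  \<open>(X|Y)\<close> is the intersection of the kernels of \<open>[1, 0]\<close> and
  \<open>[0, 1]\<close>, the form in which it is used from here on.\<close>

lemma coprod_to_prod_Comp_eq_zero_iff:
  assumes "x \<in> Obj C" "y \<in> Obj C" "u \<in> hom C t (coprod_obj C x y)"
  shows "coprod_to_prod C x y \<cdot> u = zero_arr C t (prod_obj C x y) \<longleftrightarrow>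
    copair C (Ident C x) (zero_arr C y x) \<cdot> u = zero_arr C t x \<and>
    copair C (zero_arr C x y) (Ident C y) \<cdot> u = zero_arr C t y"
proof -
  note \<sigma> = coprod_to_prod_props[OF assms(1,2)]
  note pq = proj_in_hom[OF assms(1,2)]
  note t = homD(4)[OF assms(3)]
  have P: "prod_obj C x y \<in> Obj C"
    using homD[OF pq(1)] by simp
  have "copair C (Ident C x) (zero_arr C y x) \<cdot> u = proj1 C x y \<cdot> (coprod_to_prod C x y \<cdot> u)"
    "copair C (zero_arr C x y) (Ident C y) \<cdot> u = proj2 C x y \<cdot> (coprod_to_prod C x y \<cdot> u)"
    using Comp_reassoc[OF \<sigma>(2) assms(3) \<sigma>(1) pq(1)] Comp_reassoc[OF \<sigma>(3) assms(3) \<sigma>(1) pq(2)]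
    by simp_all
  then show ?thesis
    using prod_obj_eqI[OF assms(1,2) Comp_in_hom[OF assms(3) \<sigma>(1)] zero_arr_in_hom[OF t P]]
      Comp_zero_arr[OF pq(1) t] Comp_zero_arr[OF pq(2) t] by metis
qed

lemma cosmash_incl_kernel:
  assumes "x \<in> Obj C" "y \<in> Obj C"
  shows "is_kernel C (cosmash_incl C x y) (coprod_to_prod C x y)"
  using kernel_exists[OF complete coprod_to_prod_props(1)[OF assms]]
  unfolding cosmash_incl_def by (metis someI_ex)

lemma cosmash_incl_props:
  assumes "x \<in> Obj C" "y \<in> Obj C"
  shows "cosmash_incl C x y \<in> hom C (cosmash C x y) (coprod_obj C x y)"
    "monic C (cosmash_incl C x y)"
    "copair C (Ident C x) (zero_arr C y x) \<cdot> cosmash_incl C x y = zero_arr C (cosmash C x y) x"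
    "copair C (zero_arr C x y) (Ident C y) \<cdot> cosmash_incl C x y = zero_arr C (cosmash C x y) y"
proof -
  note k = kernelD[OF cosmash_incl_kernel[OF assms] coprod_to_prod_props(1)[OF assms],
      folded cosmash_def]
  show "cosmash_incl C x y \<in> hom C (cosmash C x y) (coprod_obj C x y)" "monic C (cosmash_incl C x y)"
    using k by simp_all
  show "copair C (Ident C x) (zero_arr C y x) \<cdot> cosmash_incl C x y = zero_arr C (cosmash C x y) x"
    "copair C (zero_arr C x y) (Ident C y) \<cdot> cosmash_incl C x y = zero_arr C (cosmash C x y) y"
    using coprod_to_prod_Comp_eq_zero_iff[OF assms k(1)] k(2) by simp_all
qed

lemma cosmash_lift:
  assumes "x \<in> Obj C" "y \<in> Obj C" "u \<in> hom C t (coprod_obj C x y)"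
    and "copair C (Ident C x) (zero_arr C y x) \<cdot> u = zero_arr C t x"
    and "copair C (zero_arr C x y) (Ident C y) \<cdot> u = zero_arr C t y"
  obtains h where "h \<in> hom C t (cosmash C x y)" "cosmash_incl C x y \<cdot> h = u"
  using kernel_lift[OF cosmash_incl_kernel[OF assms(1,2)] coprod_to_prod_props(1)[OF assms(1,2)] assms(3)]
    coprod_to_prod_Comp_eq_zero_iff[OF assms(1-3)] assms(4,5) unfolding cosmash_def by metis

text \<open>The arrow \<open>[0, g]\<close> factors as \<open>g \<cdot> [0, 1]\<close>, and
  \<open>[0, 1]\<close> vanishes on the co-smash product; the second equation is the mirror
  image.\<close>

lemma copair_zero_cosmash_incl:
  assumes "x \<in> Obj C" "g \<in> hom C y b"
  shows "copair C (zero_arr C x b) g \<cdot> cosmash_incl C x y = zero_arr C (cosmash C x y) b"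
    "copair C g (zero_arr C x b) \<cdot> cosmash_incl C y x = zero_arr C (cosmash C y x) b"
proof -
  note y = homD(4)[OF assms(2)]
  note z = zero_arr_in_hom[OF assms(1) y] and i = Ident_in_hom[OF y]
  note c = cosmash_incl_props[OF assms(1) y] and d = cosmash_incl_props[OF y assms(1)]
  have "g \<cdot> copair C (zero_arr C x y) (Ident C y) = copair C (zero_arr C x b) g"
    "g \<cdot> copair C (Ident C y) (zero_arr C x y) = copair C g (zero_arr C x b)"
    using Comp_copair[OF z i assms(2)] Comp_copair[OF i z assms(2)] Comp_zero_arr[OF assms(2,1)]
      Comp_Ident_right[OF assms(2)] by simp_all
  then show "copair C (zero_arr C x b) g \<cdot> cosmash_incl C x y = zero_arr C (cosmash C x y) b"
    "copair C g (zero_arr C x b) \<cdot> cosmash_incl C y x = zero_arr C (cosmash C y x) b"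
    using Comp_assoc[OF c(1) copair_props(1)[OF z i] assms(2)] c(4)
      Comp_assoc[OF d(1) copair_props(1)[OF i z] assms(2)] d(3)
      Comp_zero_arr[OF assms(2) homD(4)[OF c(1)]] Comp_zero_arr[OF assms(2) homD(4)[OF d(1)]]
    by simp_all
qed

text \<open>The description defining \<open>(f|g)\<close> is met: \<open>[1, 0]\<close> and
  \<open>[0, 1]\<close> turn \<open>f + g\<close> into \<open>[f, 0]\<close> and
  \<open>[0, g]\<close>, which vanish on \<open>(X|Y)\<close>, so the restriction lands in the
  kernel; it is unique because the inclusion is monic.\<close>

lemma cosmash_map_props:
  assumes "f \<in> hom C x x'" "g \<in> hom C y y'"
  shows "cosmash_map C f g \<in> hom C (cosmash C x y) (cosmash C x' y')"
    "cosmash_incl C x' y' \<cdot> cosmash_map C f g = coprod_map C f g \<cdot> cosmash_incl C x y"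
proof -
  note x = homD(4,5)[OF assms(1)] and y = homD(4,5)[OF assms(2)]
  note \<iota> = cosmash_incl_props[OF x(1) y(1)] and \<iota>' = cosmash_incl_props[OF x(2) y(2)]
  note m1 = copair_coprod_map[OF assms Ident_in_hom[OF x(2)] zero_arr_in_hom[OF y(2) x(2)]]
  note m2 = copair_coprod_map[OF assms zero_arr_in_hom[OF x(2) y(2)] Ident_in_hom[OF y(2)]]
  note c1 = copair_props(1)[OF Ident_in_hom[OF x(2)] zero_arr_in_hom[OF y(2) x(2)]]
  note c2 = copair_props(1)[OF zero_arr_in_hom[OF x(2) y(2)] Ident_in_hom[OF y(2)]]
  note u = Comp_in_hom[OF \<iota>(1) m1(1)]
  have "copair C (Ident C x') (zero_arr C y' x') \<cdot> (coprod_map C f g \<cdot> cosmash_incl C x y) =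
      zero_arr C (cosmash C x y) x'"
    using Comp_reassoc[OF m1(2) \<iota>(1) m1(1) c1] Comp_Ident_left[OF assms(1)]
      zero_arr_Comp[OF assms(2) x(2)] copair_zero_cosmash_incl(2)[OF y(1) assms(1)] by simp
  moreover have "copair C (zero_arr C x' y') (Ident C y') \<cdot> (coprod_map C f g \<cdot> cosmash_incl C x y) =
      zero_arr C (cosmash C x y) y'"
    using Comp_reassoc[OF m2(2) \<iota>(1) m1(1) c2] Comp_Ident_left[OF assms(2)]
      zero_arr_Comp[OF assms(1) y(2)] copair_zero_cosmash_incl(1)[OF x(1) assms(2)] by simp
  ultimately obtain h where h: "h \<in> hom C (cosmash C x y) (cosmash C x' y')"
    "cosmash_incl C x' y' \<cdot> h = coprod_map C f g \<cdot> cosmash_incl C x y"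
    using cosmash_lift[OF x(2) y(2) u] by metis
  have eq: "cosmash_map C f g = h"
    unfolding cosmash_map_def using homD(2,3)[OF assms(1)] homD(2,3)[OF assms(2)] h
      monic_cancel[OF \<iota>'(2,1)] by (intro the_equality) (simp_all, metis)
  show "cosmash_map C f g \<in> hom C (cosmash C x y) (cosmash C x' y')"
    "cosmash_incl C x' y' \<cdot> cosmash_map C f g = coprod_map C f g \<cdot> cosmash_incl C x y"
    using h by (simp_all add: eq)
qed

text \<open>The codiagonal absorbs \<open>x + 1\<close> into \<open>[x, 1]\<close>. This replaces
  the conjugation action by \<open>[x, 1]\<close> restricted to \<open>(X|A)\<close>.\<close>

lemma conj_action_cosmash_map:
  assumes "x \<in> hom C X A"
  shows "conj_action C A \<cdot> cosmash_map C x (Ident C A) = copair C x (Ident C A) \<cdot> cosmash_incl C X A"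
proof -
  note X = homD(4,5)[OF assms]
  note i = Ident_in_hom[OF X(2)]
  note \<iota> = cosmash_incl_props(1)[OF X] and \<iota>' = cosmash_incl_props(1)[OF X(2,2)]
  note m = cosmash_map_props[OF assms i]
  note c = copair_coprod_map[OF assms i i i]
  note n = copair_props(1)[OF i i]
  have "conj_action C A \<cdot> cosmash_map C x (Ident C A) =
      copair C (Ident C A) (Ident C A) \<cdot> (coprod_map C x (Ident C A) \<cdot> cosmash_incl C X A)"
    using Comp_assoc[OF m(1) \<iota>' n] m(2) by (simp add: conj_action_def)
  then show ?thesis
    using Comp_reassoc[OF c(2) \<iota> c(1) n] Comp_Ident_left[OF assms] Comp_Ident_left[OF i] by simp
qed

lemma copair_Ident_cosmash_incl_in_hom:
  assumes "x \<in> hom C X A"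
  shows "copair C x (Ident C A) \<cdot> cosmash_incl C X A \<in> hom C (cosmash C X A) A"
  using Comp_in_hom[OF cosmash_incl_props(1)] copair_props(1)[OF assms Ident_in_hom]
    homD(4,5)[OF assms] by blast

lemma stable_under_conj_iff:
  assumes "x \<in> hom C X A"
  shows "stable_under_conj C x \<longleftrightarrow>
    (\<exists>h \<in> hom C (cosmash C X A) X. x \<cdot> h = copair C x (Ident C A) \<cdot> cosmash_incl C X A)"
  unfolding stable_under_conj_def factors_through_def
  using homD(2,3)[OF assms] conj_action_cosmash_map[OF assms]
    homD(2)[OF copair_Ident_cosmash_incl_in_hom[OF assms]] by simp

text \<open>The image is the least subobject through which the action factors: a factorization
  through \<open>x\<close> descends along the regular epimorphism part by the diagonal property, and
  conversely precomposition with that part suffices.\<close>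

lemma stable_under_conj_iff_commutator_le:
  assumes "x \<in> hom C X A" "monic C x"
  shows "stable_under_conj C x \<longleftrightarrow> subobject_le C (commutator C x (Ident C A)) x"
proof -
  define c where "c = copair C x (Ident C A) \<cdot> cosmash_incl C X A"
  have c: "c \<in> hom C (cosmash C X A) A"
    unfolding c_def using copair_Ident_cosmash_incl_in_hom[OF assms(1)] .
  define m where "m = commutator C x (Ident C A)"
  have "\<exists>m. is_image C m c"
    using image_exists[OF regular c] homD[OF c]
    unfolding is_image_def is_subobject_def by (metis homD(2,3))
  then have "is_image C (image C c) c"
    unfolding image_def by (rule someI_ex)
  then have "is_image C m c"
    using conj_action_cosmash_map[OF assms(1)] homD(3)[OF assms(1)]
    by (simp add: m_def commutator_def c_def)
  then obtain e where m: "monic C m" "m \<in> hom C (Dom C m) A"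
    and e: "e \<in> hom C (cosmash C X A) (Dom C m)" "regular_epi C e" "m \<cdot> e = c"
    using homD[OF c] by (auto simp: is_image_def is_subobject_def monic_def hom_def)
  show ?thesis
  proof
    assume "stable_under_conj C x"
    then obtain h where h: "h \<in> hom C (cosmash C X A) X" "x \<cdot> h = c"
      using stable_under_conj_iff[OF assms(1)] unfolding c_def by blast
    then obtain k where "k \<in> hom C (Dom C m) X" "x \<cdot> k = m"
      using regular_epi_monic_diagonal[OF e(2,1) assms(2,1) m(2) h(1)] e(3) by metis
    then show "subobject_le C (commutator C x (Ident C A)) x"
      using homD(2)[OF assms(1)] unfolding subobject_le_def factors_through_def m_def by blast
  next
    assume "subobject_le C (commutator C x (Ident C A)) x"
    then obtain k where k: "k \<in> hom C (Dom C m) X" "x \<cdot> k = m"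
      using homD(2)[OF assms(1)] unfolding subobject_le_def factors_through_def m_def by blast
    then have "x \<cdot> (k \<cdot> e) = c"
      using Comp_reassoc[OF k(2) e(1) k(1) assms(1)] e(3) by simp
    then show "stable_under_conj C x"
      using stable_under_conj_iff[OF assms(1)] Comp_in_hom[OF e(1) k(1)] unfolding c_def by blast
  qed
qed

text \<open>If \<open>f\<close> has kernel \<open>x\<close>, then
  \<open>f \<cdot> [x, 1] = [0, f]\<close>, which vanishes on \<open>(X|A)\<close>.\<close>

lemma proper_imp_stable_under_conj:
  assumes "x \<in> hom C X A" "proper C x"
  shows "stable_under_conj C x"
proof -
  obtain f where f: "is_kernel C x f"
    using assms(2) by (auto simp: proper_def)
  define B where "B = Cod C f"
  have fh: "f \<in> hom C A B"
    using f homD(3)[OF assms(1)] by (auto simp: is_kernel_def B_def hom_def)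
  have X: "Dom C x = X" "X \<in> Obj C" "A \<in> Obj C"
    using homD[OF assms(1)] by simp_all
  note fx = kernelD(2)[OF f fh, unfolded X(1)]
  note i = Ident_in_hom[OF X(3)]
  note \<iota> = cosmash_incl_props[OF X(2,3)]
  have "f \<cdot> (copair C x (Ident C A) \<cdot> cosmash_incl C X A) = zero_arr C (cosmash C X A) B"
    using Comp_assoc[OF \<iota>(1) copair_props(1)[OF assms(1) i] fh] Comp_copair[OF assms(1) i fh] fx
      Comp_Ident_right[OF fh] copair_zero_cosmash_incl(1)[OF X(2) fh] by simp
  then show ?thesis
    using kernel_lift[OF f fh copair_Ident_cosmash_incl_in_hom[OF assms(1)]]
      stable_under_conj_iff[OF assms(1)] X(1) by metis
qed

text \<open>The kernel of \<open>[0, 1] : X + A \<rightarrow> A\<close> is generated by \<open>X\<close> and \<open>(X|A)\<close>, because \<open>(X|A)\<close> is the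
  kernel of its projection to \<open>X\<close>, which is split by the coproduct injection.\<close>

lemma stable_under_conj_kernel:
  assumes "x \<in> hom C X A" "monic C x" "stable_under_conj C x"
    and "u \<in> hom C t (coprod_obj C X A)" "copair C (zero_arr C X A) (Ident C A) \<cdot> u = zero_arr C t A"
  obtains h where "h \<in> hom C t X" "x \<cdot> h = copair C x (Ident C A) \<cdot> u"
proof -
  have X: "X \<in> Obj C" "A \<in> Obj C"
    using homD[OF assms(1)] by simp_all
  note i = Ident_in_hom[OF X(2)] and j = Ident_in_hom[OF X(1)]
  note z = zero_arr_in_hom[OF X] and z' = zero_arr_in_hom[OF X(2,1)]
  note p2 = copair_props[OF z i] and p1 = copair_props[OF j z'] and xA = copair_props[OF assms(1) i]
  note in1 = inj_in_hom(1)[OF X]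
  note \<iota> = cosmash_incl_props[OF X]
  obtain k where k: "is_kernel C k (copair C (zero_arr C X A) (Ident C A))"
    using kernel_exists[OF complete p2(1)] .
  define K where "K = Dom C k"
  note kk = kernelD[OF k p2(1), folded K_def]
  obtain \<sigma> where \<sigma>: "\<sigma> \<in> hom C X K" "k \<cdot> \<sigma> = inj1 C X A"
    using kernel_lift[OF k p2(1) in1 p2(2)] unfolding K_def .
  obtain \<kappa> where \<kappa>: "\<kappa> \<in> hom C (cosmash C X A) K" "k \<cdot> \<kappa> = cosmash_incl C X A"
    using kernel_lift[OF k p2(1) \<iota>(1,4)] unfolding K_def .
  define p where "p = copair C (Ident C X) (zero_arr C A X) \<cdot> k"
  have p: "p \<in> hom C K X"
    unfolding p_def using Comp_in_hom[OF kk(1) p1(1)] .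
  have p\<sigma>: "p \<cdot> \<sigma> = Ident C X"
    using Comp_assoc[OF \<sigma>(1) kk(1) p1(1)] \<sigma>(2) p1(2) by (simp add: p_def)
  have ker: "is_kernel C \<kappa> p"
  proof (rule kernelI[OF p \<kappa>(1)])
    show "p \<cdot> \<kappa> = zero_arr C (cosmash C X A) X"
      using Comp_assoc[OF \<kappa>(1) kk(1) p1(1)] \<kappa>(2) \<iota>(3) by (simp add: p_def)
    have "g = h" if gh: "g \<in> hom C t (cosmash C X A)" "h \<in> hom C t (cosmash C X A)" "\<kappa> \<cdot> g = \<kappa> \<cdot> h" for t g h
      using Comp_reassoc[OF \<kappa>(2) gh(1) \<kappa>(1) kk(1)] Comp_reassoc[OF \<kappa>(2) gh(2) \<kappa>(1) kk(1)] gh(3)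
        monic_cancel[OF \<iota>(2,1) gh(1,2)] by simp
    then show "monic C \<kappa>"
      using homD[OF \<kappa>(1)] by (auto simp: monic_def)
    fix t v
    assume v: "v \<in> hom C t K" "p \<cdot> v = zero_arr C t X"
    note kv = Comp_in_hom[OF v(1) kk(1)]
    have "copair C (Ident C X) (zero_arr C A X) \<cdot> (k \<cdot> v) = zero_arr C t X"
      using Comp_assoc[OF v(1) kk(1) p1(1)] v(2) by (simp add: p_def)
    moreover have "copair C (zero_arr C X A) (Ident C A) \<cdot> (k \<cdot> v) = zero_arr C t A"
      using Comp_reassoc[OF kk(2) v(1) kk(1) p2(1)] zero_arr_Comp[OF v(1) X(2)] by simp
    ultimately obtain h where h: "h \<in> hom C t (cosmash C X A)" "cosmash_incl C X A \<cdot> h = k \<cdot> v"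
      using cosmash_lift[OF X kv] by blast
    then have "k \<cdot> (\<kappa> \<cdot> h) = k \<cdot> v"
      using Comp_reassoc[OF \<kappa>(2) h(1) \<kappa>(1) kk(1)] by simp
    then show "\<exists>h \<in> hom C t (cosmash C X A). \<kappa> \<cdot> h = v"
      using monic_cancel[OF kk(3,1) Comp_in_hom[OF h(1) \<kappa>(1)] v(1)] h(1) by blast
  qed
  define f where "f = copair C x (Ident C A) \<cdot> k"
  have f: "f \<in> hom C K A"
    unfolding f_def using Comp_in_hom[OF kk(1) xA(1)] .
  have "f \<cdot> \<sigma> = x"
    using Comp_assoc[OF \<sigma>(1) kk(1) xA(1)] \<sigma>(2) xA(2) by (simp add: f_def)
  \<comment> \<open>The relation \<open>(x, x)\<close> encodes factoring through \<open>x\<close>: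
    on the section \<open>f\<close> is \<open>x\<close> itself, and on the kernel
    \<open>\<kappa>\<close> the factorization is the stability hypothesis.\<close>
  then have 1: "related x x (f \<cdot> \<sigma>) (f \<cdot> \<sigma>)"
    using relatedI[OF assms(1,1) j] Comp_Ident_right[OF assms(1)] by metis
  have f\<kappa>: "f \<cdot> \<kappa> = copair C x (Ident C A) \<cdot> cosmash_incl C X A"
    using Comp_assoc[OF \<kappa>(1) kk(1) xA(1)] \<kappa>(2) by (simp add: f_def)
  obtain h where "h \<in> hom C (cosmash C X A) X" "x \<cdot> h = f \<cdot> \<kappa>"
    using assms(3) stable_under_conj_iff[OF assms(1)] f\<kappa> by auto
  then have 2: "related x x (f \<cdot> \<kappa>) (f \<cdot> \<kappa>)"
    using relatedI[OF assms(1) Comp_in_hom[OF \<kappa>(1) f]] by blast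
  have "related x x f f"
    using point_kernel_related[OF p \<sigma>(1) p\<sigma> ker monic_imp_jointly_monic[OF assms(2,1)] assms(1,1) f f 1 2] .
  then obtain l where l: "l \<in> hom C K X" "x \<cdot> l = f"
    using relatedE[OF _ assms(1) f] by metis
  obtain w where w: "w \<in> hom C t K" "k \<cdot> w = u"
    using kernel_lift[OF k p2(1) assms(4,5)] unfolding K_def .
  have "x \<cdot> (l \<cdot> w) = copair C x (Ident C A) \<cdot> u"
    using Comp_reassoc[OF l(2) w(1) l(1) assms(1)] Comp_assoc[OF w(1) kk(1) xA(1)] w(2)
    by (simp add: f_def)
  then show thesis
    using that Comp_in_hom[OF w(1) l(1)] by blast
qed

text \<open>\<open>X\<close> is the zero class of the reflexive relation on \<open>A\<close> generated by \<open>(0, x)\<close>, the image of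
  \<open>\<langle>[0, 1], [x, 1]\<rangle> : X + A \<rightarrow> A \<times> A\<close>; exactness makes this relation a kernel pair.\<close>

lemma stable_under_conj_imp_proper:
  assumes "barr_exact C" "x \<in> hom C X A" "monic C x" "stable_under_conj C x"
  shows "proper C x"
proof -
  have X: "X \<in> Obj C" "A \<in> Obj C"
    using homD[OF assms(2)] by simp_all
  define S where "S = coprod_obj C X A"
  note i = Ident_in_hom[OF X(2)] and z = zero_arr_in_hom[OF X]
  note p = copair_props[OF z i, folded S_def] and q = copair_props[OF assms(2) i, folded S_def]
  note in1 = inj_in_hom(1)[OF X, folded S_def] and in2 = inj_in_hom(2)[OF X, folded S_def]
  define g where "g = pair C (copair C (zero_arr C X A) (Ident C A)) (copair C x (Ident C A))"
  note g = pair_props[OF p(1) q(1), folded g_def]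
  obtain R e m where e: "e \<in> hom C S R" "regular_epi C e" and m: "m \<in> hom C R (prod_obj C A A)" "monic C m"
    and me: "m \<cdot> e = g"
    using image_exists[OF regular g(1)] by metis
  note \<pi> = proj_in_hom[OF X(2,2)]
  define r where "r = proj1 C A A \<cdot> m"
  define s where "s = proj2 C A A \<cdot> m"
  have r: "r \<in> hom C R A" and s: "s \<in> hom C R A"
    unfolding r_def s_def using Comp_in_hom m(1) \<pi> by blast+
  have re: "r \<cdot> e = copair C (zero_arr C X A) (Ident C A)" and se: "s \<cdot> e = copair C x (Ident C A)"
    using Comp_assoc[OF e(1) m(1) \<pi>(1)] Comp_assoc[OF e(1) m(1) \<pi>(2)] me g(2,3)
    by (simp_all add: r_def s_def)
  have jm: "jointly_monic r s"
    unfolding jointly_monic_def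
  proof (intro allI ballI impI)
    fix t h k
    assume "h \<in> hom C t (Dom C r)" "k \<in> hom C t (Dom C r)" and eq: "r \<cdot> h = r \<cdot> k \<and> s \<cdot> h = s \<cdot> k"
    then have hk: "h \<in> hom C t R" "k \<in> hom C t R"
      using homD[OF r] by simp_all
    have "m \<cdot> h = m \<cdot> k"
      using prod_obj_eqI[OF X(2,2) Comp_in_hom[OF hk(1) m(1)] Comp_in_hom[OF hk(2) m(1)]] eq
        Comp_assoc[OF hk(1) m(1) \<pi>(1)] Comp_assoc[OF hk(2) m(1) \<pi>(1)]
        Comp_assoc[OF hk(1) m(1) \<pi>(2)] Comp_assoc[OF hk(2) m(1) \<pi>(2)]
      by (simp add: r_def s_def)
    then show "h = k"
      using monic_cancel[OF m(2,1) hk] by simp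
  qed
  \<comment> \<open>Reflexivity comes from the summand \<open>A\<close>, on which
    \<open>[0, 1]\<close> and \<open>[x, 1]\<close> are both the identity.\<close>
  have "r \<cdot> (e \<cdot> inj2 C X A) = Ident C A" "s \<cdot> (e \<cdot> inj2 C X A) = Ident C A"
    using Comp_reassoc[OF re in2 e(1) r] Comp_reassoc[OF se in2 e(1) s] p(3) q(3) by simp_all
  then have "is_equivalence_relation C A R r s"
    using reflexive_relation_is_equivalence[OF jm r s Comp_in_hom[OF in2 e(1)]] by simp
  then obtain f where "is_kernel_pair C r s f"
    using assms(1) unfolding barr_exact_def by blast
  then have kp: "is_pullback C r s f f"
    by (simp add: is_kernel_pair_def)
  define B where "B = Cod C f"
  have f: "f \<in> hom C A B"
    using kp homD[OF r] by (auto simp: is_pullback_def B_def hom_def)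
  note fr = pullbackD(2)[OF kp r f f]
  have rs1: "r \<cdot> (e \<cdot> inj1 C X A) = zero_arr C X A" "s \<cdot> (e \<cdot> inj1 C X A) = x"
    using Comp_reassoc[OF re in1 e(1) r] Comp_reassoc[OF se in1 e(1) s] p(2) q(2) by simp_all
  have "is_kernel C x f"
  proof (rule kernelI[OF f assms(2) _ _ assms(3)])
    show "f \<cdot> x = zero_arr C X B"
      using Comp_reassoc[OF fr Comp_in_hom[OF in1 e(1)] r f]
        Comp_assoc[OF Comp_in_hom[OF in1 e(1)] s f] rs1 Comp_zero_arr[OF f X(1)] by simp
    fix t u
    assume u: "u \<in> hom C t A" and fu: "f \<cdot> u = zero_arr C t B"
    have t: "t \<in> Obj C"
      using homD[OF u] by simp
    obtain y where y: "y \<in> hom C t R" "r \<cdot> y = zero_arr C t A" "s \<cdot> y = u"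
      using pullback_lift[OF kp r f f zero_arr_in_hom[OF t X(2)] u] fu Comp_zero_arr[OF f t] by metis
    \<comment> \<open>The pair \<open>(0, u)\<close> lies in the image \<open>R\<close>, so it lifts
      to \<open>a\<close> in \<open>X + A\<close> on the cover \<open>b\<close>. Then
      \<open>a\<close> lies in the kernel of \<open>[0, 1]\<close>, and stability puts
      \<open>u \<cdot> b = [x, 1] \<cdot> a\<close> in \<open>X\<close>.\<close>
    obtain w a b where ab: "a \<in> hom C w S" "b \<in> hom C w t" "e \<cdot> a = y \<cdot> b" "regular_epi C b"
      using regular_pullback_regular_epi[OF regular e(2,1) y(1)] .
    have "copair C (zero_arr C X A) (Ident C A) \<cdot> a = r \<cdot> (y \<cdot> b)"
      using Comp_reassoc[OF re ab(1) e(1) r] ab(3) by simp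
    also have "\<dots> = zero_arr C w A"
      using Comp_reassoc[OF y(2) ab(2) y(1) r] zero_arr_Comp[OF ab(2) X(2)] by simp
    finally obtain h where h: "h \<in> hom C w X" "x \<cdot> h = copair C x (Ident C A) \<cdot> a"
      using stable_under_conj_kernel[OF assms(2-4) ab(1)[unfolded S_def]] by blast
    have "u \<cdot> b = x \<cdot> h"
      using Comp_reassoc[OF se ab(1) e(1) s] ab(3) h(2) Comp_reassoc[OF y(3) ab(2) y(1) s] by simp
    then show "\<exists>h \<in> hom C t X. x \<cdot> h = u"
      using regular_epi_monic_diagonal[OF ab(4,2) assms(3,2) u h(1)] by metis
  qed
  then show ?thesis
    by (auto simp: proper_def)
qed

text \<open>The normalization \<open>k\<close> of an equivalence relation is stable, hence the kernel of some \<open>f\<close>. As a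
  reflexive relation is determined by its zero class, the relation is the kernel pair of \<open>f\<close>.\<close>

lemma barr_exactI:
  assumes proper: "\<And>A X x. x \<in> hom C X A \<Longrightarrow> monic C x \<Longrightarrow> stable_under_conj C x \<Longrightarrow> proper C x"
  shows "barr_exact C"
  unfolding barr_exact_def
proof (intro conjI allI impI regular)
  fix A R r s
  assume eq: "is_equivalence_relation C A R r s"
  then have r: "r \<in> hom C R A" and s: "s \<in> hom C R A"
    by (simp_all add: is_equivalence_relation_def)
  have jm: "jointly_monic r s"
    using eq homD(2)[OF r] unfolding is_equivalence_relation_def jointly_monic_def by simp
  obtain d where d: "d \<in> hom C A R" "r \<cdot> d = Ident C A" "s \<cdot> d = Ident C A"
    using eq unfolding is_equivalence_relation_def by blast
  have A: "A \<in> Obj C"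
    using homD[OF r] by simp
  note i = Ident_in_hom[OF A]
  obtain \<kappa> where \<kappa>: "is_kernel C \<kappa> r"
    using kernel_exists[OF complete r] .
  define K where "K = Dom C \<kappa>"
  note \<kappa>' = kernelD[OF \<kappa> r, folded K_def]
  have K: "K \<in> Obj C"
    using homD[OF \<kappa>'(1)] by simp
  define k where "k = s \<cdot> \<kappa>"
  have k: "k \<in> hom C K A"
    unfolding k_def using Comp_in_hom[OF \<kappa>'(1) s] .
  have mono: "monic C k"
    unfolding monic_def
  proof (intro conjI allI ballI impI)
    show "k \<in> Arr C"
      using homD[OF k] by simp
    fix t g h
    assume "g \<in> hom C t (Dom C k)" "h \<in> hom C t (Dom C k)" and e: "k \<cdot> g = k \<cdot> h"
    then have gh: "g \<in> hom C t K" "h \<in> hom C t K"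
      using homD[OF k] by simp_all
    \<comment> \<open>On the kernel of \<open>r\<close> the first component is always zero, so
      \<open>s\<close> alone separates its elements.\<close>
    have "\<kappa> \<cdot> g = \<kappa> \<cdot> h"
      using jointly_monicD[OF jm r Comp_in_hom[OF gh(1) \<kappa>'(1)] Comp_in_hom[OF gh(2) \<kappa>'(1)]] e
        Comp_reassoc[OF \<kappa>'(2) gh(1) \<kappa>'(1) r] Comp_reassoc[OF \<kappa>'(2) gh(2) \<kappa>'(1) r]
        zero_arr_Comp[OF gh(1) A] zero_arr_Comp[OF gh(2) A]
        Comp_assoc[OF gh(1) \<kappa>'(1) s] Comp_assoc[OF gh(2) \<kappa>'(1) s] by (simp add: k_def)
    then show "g = h"
      using monic_cancel[OF \<kappa>'(3,1) gh] by simp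
  qed
  note \<iota> = cosmash_incl_props[OF K A]
  \<comment> \<open>The arrow \<open>[\<kappa>, d] : K + A \<rightarrow> R\<close> has components
    \<open>[0, 1]\<close> and \<open>[k, 1]\<close>. The first vanishes on \<open>(K|A)\<close>, so
    the restriction lands in the kernel of \<open>r\<close>; its second component then gives
    stability of \<open>k\<close>.\<close>
  note c = copair_props[OF \<kappa>'(1) d(1)]
  note c\<iota> = Comp_in_hom[OF \<iota>(1) c(1)]
  have "r \<cdot> (copair C \<kappa> d \<cdot> cosmash_incl C K A) = zero_arr C (cosmash C K A) A"
    using Comp_assoc[OF \<iota>(1) c(1) r] Comp_copair[OF \<kappa>'(1) d(1) r] \<kappa>'(2) d(2) \<iota>(4) by simp
  then obtain h where h: "h \<in> hom C (cosmash C K A) K" "\<kappa> \<cdot> h = copair C \<kappa> d \<cdot> cosmash_incl C K A"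
    using kernel_lift[OF \<kappa> r c\<iota>] unfolding K_def by metis
  have "k \<cdot> h = copair C k (Ident C A) \<cdot> cosmash_incl C K A"
    using Comp_assoc[OF h(1) \<kappa>'(1) s] h(2) Comp_assoc[OF \<iota>(1) c(1) s]
      Comp_copair[OF \<kappa>'(1) d(1) s] d(3) by (simp add: k_def)
  then have "stable_under_conj C k"
    using stable_under_conj_iff[OF k] h(1) by blast
  then obtain f where ker: "is_kernel C k f"
    using proper[OF k mono] by (auto simp: proper_def)
  define B where "B = Cod C f"
  have f: "f \<in> hom C A B"
    using ker homD[OF k] by (auto simp: is_kernel_def B_def hom_def)
  have B: "B \<in> Obj C" and kK: "Dom C k = K"
    using homD[OF f] homD[OF k] by simp_all
  note fk = kernelD(2)[OF ker f, unfolded kK]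
  have iB: "Ident C B \<in> hom C B B"
    using Ident_in_hom[OF B] .
  \<comment> \<open>Equality on \<open>B\<close> as a relation, so that
    \<open>point_kernel_related\<close> can prove \<open>f \<cdot> r = f \<cdot> s\<close> from
    agreement on \<open>d\<close> and \<open>\<kappa>\<close>.\<close>
  have jB: "jointly_monic (Ident C B) (Ident C B)"
    using Comp_Ident_left homD(2)[OF iB] unfolding jointly_monic_def by metis
  have diag: "related (Ident C B) (Ident C B) g h \<longleftrightarrow> g = h" if g: "g \<in> hom C t B" for g h t
  proof
    show "g = h" if "related (Ident C B) (Ident C B) g h"
      using relatedE[OF that iB g] by metis
    show "related (Ident C B) (Ident C B) g h" if "g = h"
      using relatedI[OF iB g g Comp_Ident_left[OF g] Comp_Ident_left[OF g]] that by blast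
  qed
  note fr = Comp_in_hom[OF r f] and fs = Comp_in_hom[OF s f]
  have "(f \<cdot> r) \<cdot> d = (f \<cdot> s) \<cdot> d"
    using Comp_assoc[OF d(1) r f] Comp_assoc[OF d(1) s f] d(2,3) by simp
  moreover have "(f \<cdot> r) \<cdot> \<kappa> = (f \<cdot> s) \<cdot> \<kappa>"
    using Comp_assoc[OF \<kappa>'(1) r f] Comp_assoc[OF \<kappa>'(1) s f] \<kappa>'(2) fk Comp_zero_arr[OF f K]
    by (simp add: k_def)
  ultimately have "related (Ident C B) (Ident C B) (f \<cdot> r) (f \<cdot> s)"
    using point_kernel_related[OF r d(1,2) \<kappa> jB iB iB fr fs]
      diag[OF Comp_in_hom[OF d(1) fr]] diag[OF Comp_in_hom[OF \<kappa>'(1) fr]] by simp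
  then have fr_fs: "f \<cdot> r = f \<cdot> s"
    using diag[OF fr] by simp
  \<comment> \<open>For the reverse inclusion the kernel pair of \<open>f\<close> is itself a point
    over \<open>A\<close>, with the diagonal \<open>\<delta>\<close> as section. On the kernel
    \<open>n\<close> of \<open>a\<close>, the arrow \<open>b \<cdot> n\<close> is killed by
    \<open>f\<close>, hence lies in \<open>k\<close>, the zero class of the given relation.\<close>
  obtain Q a b where ab: "a \<in> hom C Q A" "b \<in> hom C Q A" "is_pullback C a b f f"
    using pullback_exists[OF complete f f] .
  obtain \<delta> where \<delta>: "\<delta> \<in> hom C A Q" "a \<cdot> \<delta> = Ident C A" "b \<cdot> \<delta> = Ident C A"
    using pullback_lift[OF ab(3,1) f f i i] by blast
  obtain n where n: "is_kernel C n a"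
    using kernel_exists[OF complete ab(1)] .
  define N where "N = Dom C n"
  note n' = kernelD[OF n ab(1), folded N_def]
  have N: "N \<in> Obj C"
    using homD[OF n'(1)] by simp
  have "f \<cdot> (b \<cdot> n) = zero_arr C N B"
    using Comp_reassoc[OF pullbackD(2)[OF ab(3,1) f f, symmetric] n'(1) ab(2) f]
      Comp_assoc[OF n'(1) ab(1) f] n'(2) Comp_zero_arr[OF f N] by simp
  then obtain l where l: "l \<in> hom C N K" "k \<cdot> l = b \<cdot> n"
    using kernel_lift[OF ker f Comp_in_hom[OF n'(1) ab(2)]] kK by metis
  have "r \<cdot> (\<kappa> \<cdot> l) = a \<cdot> n" "s \<cdot> (\<kappa> \<cdot> l) = b \<cdot> n"
    using Comp_reassoc[OF \<kappa>'(2) l(1) \<kappa>'(1) r] zero_arr_Comp[OF l(1) A] n'(2)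
      Comp_assoc[OF l(1) \<kappa>'(1) s] l(2) by (simp_all add: k_def)
  then have 1: "related r s (a \<cdot> n) (b \<cdot> n)"
    using relatedI[OF r Comp_in_hom[OF n'(1) ab(1)] Comp_in_hom[OF l(1) \<kappa>'(1)]] by blast
  have 2: "related r s (a \<cdot> \<delta>) (b \<cdot> \<delta>)"
    using relatedI[OF r i d] \<delta>(2,3) by simp
  have rel: "related r s a b"
    using point_kernel_related[OF ab(1) \<delta>(1,2) n jm r s ab(1,2) 2 1] .
  have "is_pullback C r s f f"
  proof (rule pullbackI[OF f f r s fr_fs])
    fix t g h
    assume gh: "g \<in> hom C t A" "h \<in> hom C t A" "f \<cdot> g = f \<cdot> h"
    obtain w where w: "w \<in> hom C t Q" "a \<cdot> w = g" "b \<cdot> w = h"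
      using pullback_lift[OF ab(3,1) f f gh] .
    then have "related r s g h"
      using related_Comp[OF rel r s ab(1,2) w(1)] by simp
    then obtain v where v: "v \<in> hom C t R" "r \<cdot> v = g" "s \<cdot> v = h"
      using relatedE[OF _ r gh(1)] by metis
    show "\<exists>!v. v \<in> hom C t R \<and> r \<cdot> v = g \<and> s \<cdot> v = h"
    proof (rule ex1I[of _ v])
      show "w = v" if "w \<in> hom C t R \<and> r \<cdot> w = g \<and> s \<cdot> w = h" for w
        using that v by (intro jointly_monicD[OF jm r _ v(1)]) simp_all
    qed (use v in simp)
  qed
  then show "\<exists>f. is_kernel_pair C r s f"
    by (auto simp: is_kernel_pair_def)
qed

lemma semi_abelian_iff_barr_exact: "semi_abelian C \<longleftrightarrow> barr_exact C"
  using pointed protomodular coproduct_exists[OF cocomplete]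
  unfolding semi_abelian_def has_binary_coproducts_def by blast

end

theorem corollary24:
  fixes C :: "('o, 'm) cat"
  assumes "category C"
    and "homological C"
    and "finitely_cocomplete C"
  shows
    "(semi_abelian C \<longleftrightarrow> barr_exact C) \<and>
     (\<forall>A x. is_subobject C x A \<longrightarrow>
        (stable_under_conj C x \<longleftrightarrow> subobject_le C (commutator C x (Ident C A)) x)) \<and>
     (semi_abelian C \<longleftrightarrow>
        (\<forall>A x. is_subobject C x A \<longrightarrow> (proper C x \<longleftrightarrow> stable_under_conj C x)))"
proof -
  interpret category C
    by fact
  interpret cocomplete_homological_category C
    by unfold_locales fact+
  have sub: "is_subobject C x A \<longleftrightarrow> x \<in> hom C (Dom C x) A \<and> monic C x" for x A
    by (auto simp: is_subobject_def monic_def hom_def)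
  have "barr_exact C \<longleftrightarrow>
      (\<forall>A x. is_subobject C x A \<longrightarrow> (proper C x \<longleftrightarrow> stable_under_conj C x))"
  proof
    show "\<forall>A x. is_subobject C x A \<longrightarrow> (proper C x \<longleftrightarrow> stable_under_conj C x)" if "barr_exact C"
      using that proper_imp_stable_under_conj stable_under_conj_imp_proper unfolding sub by blast
    assume "\<forall>A x. is_subobject C x A \<longrightarrow> (proper C x \<longleftrightarrow> stable_under_conj C x)"
    then show "barr_exact C"
      using homD(2) unfolding sub by (intro barr_exactI) blast
  qed
  moreover have "\<forall>A x. is_subobject C x A \<longrightarrow>
      (stable_under_conj C x \<longleftrightarrow> subobject_le C (commutator C x (Ident C A)) x)"
    using stable_under_conj_iff_commutator_le unfolding sub by blast
  ultimately show ?thesis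
    using semi_abelian_iff_barr_exact by simp
qed

end
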